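(* Let $d\ge 1$ and $a<b$. The space $\mathscr{D}([a,b],\mathbb{R}^d)$ of decorated paths with metric $\alpha_\infty$ is the completion of the càdlàg space $D([a,b],\mathbb{R}^d)$ with respect to the standard $\mathcal{J}_1$ metric $\sigma_\infty$. That is, $(\mathscr{D}([a,b],\mathbb{R}^d),\alpha_\infty)$ is a complete metric space and the trivial lift $\iota:(D([a,b],\mathbb{R}^d),\sigma_\infty)\to(\mathscr{D}([a,b],\mathbb{R}^d),\alpha_\infty)$ is an isometry onto a dense subset.
   Context: Fix $d\ge1$ and a compact interval $I=[a,b]$. $D(I,\mathbb{R}^d)$ is the space of càdlàg functions $I\to\mathbb{R}^d$, $|\cdot|_\infty$ is the sup norm, and the $\mathcal{J}_1$ metric is $$\sigma_{\infty;I}(h_1,h_2)=\inf_{\rho}\max\{\sup_{x\in I}|\rho(x)-x|,\ |h_1\circ\rho-h_2|_\infty\},$$ the infimum being over continuous increasing bijections $\rho:I\to I$. For $\phi:I\to D([0,1],\mathbb{R}^d)$, a point $t\in I$ is stationary if $\phi(t)$ is a constant path. $\overline{\mathscr{D}}(I,\mathbb{R}^d)$ is the set of pairs $(\phi,\Pi)$ where $\phi:I\to D([0,1],\mathbb{R}^d)$ and: (a) $t\mapsto\phi(t)(1)$ is càdlàg on $I$; (b) $\Pi\subset I$ is at most countable (possibly empty) and contains all non-stationary points of $\phi$; (c) for every $\varepsilon>0$ there are only finitely many $t\in\Pi$ with $\sup_{s\in[0,1]}|\phi(t)(s)-\phi(t)(0)|>\varepsilon$. $\delta$-extension: let $\delta>0$,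 $(\phi,\Pi)\in\overline{\mathscr{D}}([a,b],\mathbb{R}^d)$, $\Pi=\{t_j:1\le j<\kappa+1\}$ with $\kappa\in\{0,1,\dots\}\cup\{\infty\}$ the cardinality of $\Pi$. If $\kappa=0$, put $\phi^\delta(u)=\phi(\min\{u,b\})(1)$ for $u\in[a,b+\delta]$. Otherwise let $r=\sum_{j=1}^\kappa2^{-j}$ and $\tau_\delta(t)=t+\sum_{j=1}^\kappa\frac{\delta2^{-j}}{r}\mathbf{1}_{t_j\le t}$ for $t\in[a,b]$ (with $\tau_\delta(a^-)=a$), and for $u\in[a,b+\delta]$ put $\phi^\delta(u)=\phi(t)(1)$ if $u=\tau_\delta(t)$ for some $t\in[a,b]$, and $\phi^\delta(u)=\phi(t_j)\big(\frac{u-\tau_\delta(t_j^-)}{\delta2^{-j}/r}\big)$ if $u\in[\tau_\delta(t_j^-),\tau_\delta(t_j))$. Then $\phi^\delta\in D([a,b+\delta],\mathbb{R}^d)$. For $(\phi_1,\Pi_1),(\phi_2,\Pi_2)\in\overline{\mathscr{D}}([a,b],\mathbb{R}^d)$ set $\alpha_\infty(\phi_1,\phi_2)=\lim_{\delta\to0}\sigma_{\infty;[a,b+\delta]}(\phi_1^\delta,\phi_2^\delta)$; the limit exists and is independent of the choices of $\Pi_i$ and their enumerations, so $\Pi$ is suppressed from the notation. $\mathscr{D}([a,b],\mathbb{R}^d)$ is the quotient of $\overline{\mathscr{D}}([a,b],\mathbb{R}^d)$ obtained by identifying $\phi_1,\phi_2$ when $\alpha_\infty(\phi_1,\phi_2)=0$.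 The trivial lift $\iota:D(I,\mathbb{R}^d)\to\mathscr{D}(I,\mathbb{R}^d)$ is $(\iota h)(t)(s)=h(t)$ for $t\in I$, $s\in[0,1]$.
   Formalization: The trivial lift is taken with Π={a}: for paths jumping at b the class of ιh depends on Π, contrary to the stated independence, and with Π=∅ the isometry fails (1_{b} and 1_{[b-η,b]} have σ_∞=1, but α_∞≤η). *)

theory Defs
  imports "HOL-Analysis.Analysis"
begin

section \<open>Cadlag paths and the J1 metric\<close>

text \<open>One-sided limits are taken within the domain, so nothing is required from the left at the
  left endpoint or from the right at the right endpoint; in particular a path may jump at its
  right endpoint.\<close>

definition cadlag_on :: "real set \<Rightarrow> (real \<Rightarrow> 'a::topological_space) \<Rightarrow> bool" where
  "cadlag_on I h \<longleftrightarrow>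
     (\<forall>t\<in>I. (h \<longlongrightarrow> h t) (at t within I \<inter> {t<..}) \<and>
            (\<exists>l. (h \<longlongrightarrow> l) (at t within I \<inter> {..<t})))"

definition cadlag_space :: "real set \<Rightarrow> (real \<Rightarrow> 'a::topological_space) set" where
  "cadlag_space I = {h \<in> extensional I. cadlag_on I h}"

definition reparams :: "real set \<Rightarrow> (real \<Rightarrow> real) set" where
  "reparams I = {\<rho>. continuous_on I \<rho> \<and> strict_mono_on I \<rho> \<and> bij_betw \<rho> I I}"

definition J1_dist :: "real set \<Rightarrow> (real \<Rightarrow> 'a::real_normed_vector) \<Rightarrow> (real \<Rightarrow> 'a) \<Rightarrow> real" where
  "J1_dist I h1 h2 =
     (INF \<rho>\<in>reparams I. max (SUP x\<in>I. \<bar>\<rho> x - x\<bar>) (SUP x\<in>I. norm (h1 (\<rho> x) - h2 x)))"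


section \<open>Decorated paths\<close>

definition stationary :: "(real \<Rightarrow> real \<Rightarrow> 'a) \<Rightarrow> real \<Rightarrow> bool" where
  "stationary \<phi> t \<longleftrightarrow> (\<exists>c. \<forall>s\<in>{0..1}. \<phi> t s = c)"

definition decorated_pairs ::
    "real \<Rightarrow> real \<Rightarrow> ((real \<Rightarrow> real \<Rightarrow> 'a::real_normed_vector) \<times> real set) set" where
  "decorated_pairs a b =
     {(\<phi>, P). \<phi> \<in> {a..b} \<rightarrow>\<^sub>E cadlag_space {0..1} \<and>
        cadlag_on {a..b} (\<lambda>t. \<phi> t 1) \<and>
        P \<subseteq> {a..b} \<and> countable P \<and> (\<forall>t\<in>{a..b}. \<not> stationary \<phi> t \<longrightarrow> t \<in> P) \<and>
        (\<forall>\<epsilon>>0. finite {t\<in>P. (SUP s\<in>{0..1}. norm (\<phi> t s - \<phi> t 0)) > \<epsilon>})}"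

text \<open>The index set \<open>{j. 1 \<le> j < \<kappa> + 1}\<close>, where \<open>\<kappa>\<close> is the cardinality of \<open>P\<close>.\<close>

definition index_set :: "real set \<Rightarrow> nat set" where
  "index_set P = (if finite P then {1..card P} else {1..})"

definition enumerates :: "(nat \<Rightarrow> real) \<Rightarrow> real set \<Rightarrow> bool" where
  "enumerates e P \<longleftrightarrow> bij_betw e (index_set P) P"

definition width :: "real set \<Rightarrow> real \<Rightarrow> nat \<Rightarrow> real" where
  "width P \<delta> j = \<delta> * (1/2) ^ j / (\<Sum>\<^sub>\<infinity>i\<in>index_set P. (1/2) ^ i)"

definition tau :: "real set \<Rightarrow> (nat \<Rightarrow> real) \<Rightarrow> real \<Rightarrow> real \<Rightarrow> real" where
  "tau P e \<delta> t = t + (\<Sum>\<^sub>\<infinity>j\<in>index_set P. width P \<delta> j * of_bool (e j \<le> t))"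

text \<open>The left limit of \<^const>\<open>tau\<close>, with the convention \<open>\<tau>(a\<^sup>-) = a\<close> at the left endpoint.\<close>

definition tau_left :: "real \<Rightarrow> real set \<Rightarrow> (nat \<Rightarrow> real) \<Rightarrow> real \<Rightarrow> real \<Rightarrow> real" where
  "tau_left a P e \<delta> t = (if t = a then a else Lim (at_left t) (tau P e \<delta>))"

definition delta_extension ::
    "real \<Rightarrow> real \<Rightarrow> (real \<Rightarrow> real \<Rightarrow> 'a) \<Rightarrow> real set \<Rightarrow> (nat \<Rightarrow> real) \<Rightarrow> real \<Rightarrow> real \<Rightarrow> 'a" where
  "delta_extension a b \<phi> P e \<delta> = (\<lambda>u\<in>{a..b+\<delta>}.
     if P = {} then \<phi> (min u b) 1
     else if \<exists>t\<in>{a..b}. u = tau P e \<delta> t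
     then \<phi> (THE t. t \<in> {a..b} \<and> u = tau P e \<delta> t) 1
     else (let j = (THE j. j \<in> index_set P \<and>
                       tau_left a P e \<delta> (e j) \<le> u \<and> u < tau P e \<delta> (e j))
           in \<phi> (e j) ((u - tau_left a P e \<delta> (e j)) / width P \<delta> j)))"

text \<open>The limit as \<open>\<delta> \<down> 0\<close>, required to be the same for all enumerations of the two sets.\<close>

definition alpha ::
    "real \<Rightarrow> real \<Rightarrow> (real \<Rightarrow> real \<Rightarrow> 'a::real_normed_vector) \<times> real set \<Rightarrow>
      (real \<Rightarrow> real \<Rightarrow> 'a) \<times> real set \<Rightarrow> real" where
  "alpha a b = (\<lambda>(\<phi>1, P1) (\<phi>2, P2).
     (THE L. \<forall>e1 e2. enumerates e1 P1 \<longrightarrow> enumerates e2 P2 \<longrightarrow>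
        ((\<lambda>\<delta>. J1_dist {a..b+\<delta>} (delta_extension a b \<phi>1 P1 e1 \<delta>)
                                (delta_extension a b \<phi>2 P2 e2 \<delta>)) \<longlongrightarrow> L) (at_right 0)))"

definition alpha_rel ::
    "real \<Rightarrow> real \<Rightarrow> (((real \<Rightarrow> real \<Rightarrow> 'a::real_normed_vector) \<times> real set) \<times>
                    ((real \<Rightarrow> real \<Rightarrow> 'a) \<times> real set)) set" where
  "alpha_rel a b =
     {(x, y). x \<in> decorated_pairs a b \<and> y \<in> decorated_pairs a b \<and> alpha a b x y = 0}"

definition decorated_space ::
    "real \<Rightarrow> real \<Rightarrow> ((real \<Rightarrow> real \<Rightarrow> 'a::real_normed_vector) \<times> real set) set set" where
  "decorated_space a b = decorated_pairs a b // alpha_rel a b"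

text \<open>The distance induced on classes. The locale \<^locale>\<open>Metric_space\<close> asks for nonnegativity and
  symmetry on the whole type, hence the default value off the space.\<close>

definition alpha_dist ::
    "real \<Rightarrow> real \<Rightarrow> ((real \<Rightarrow> real \<Rightarrow> 'a::real_normed_vector) \<times> real set) set \<Rightarrow>
      ((real \<Rightarrow> real \<Rightarrow> 'a) \<times> real set) set \<Rightarrow> real" where
  "alpha_dist a b X Y =
     (if X \<in> decorated_space a b \<and> Y \<in> decorated_space a b
      then (THE r. \<forall>x\<in>X. \<forall>y\<in>Y. alpha a b x y = r) else 0)"

definition trivial_path :: "real set \<Rightarrow> (real \<Rightarrow> 'a) \<Rightarrow> real \<Rightarrow> real \<Rightarrow> 'a" where
  "trivial_path I h = (\<lambda>t\<in>I. \<lambda>s\<in>{0..1}. h t)"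

text \<open>Every countable subset of \<open>[a,b]\<close> contains all non-stationary points of a trivial lift; we
  use \<open>{a}\<close>. The choice matters only for a path that jumps at \<open>b\<close>. If \<open>P\<close> is nonempty and
  \<open>b \<notin> P\<close>, its extension jumps at the right endpoint \<open>b + \<delta>\<close>, which reparametrisations fix just
  as they fix \<open>b\<close>. If \<open>P = {}\<close> or \<open>b \<in> P\<close>, the extension jumps at \<open>b\<close> and is constant
  afterwards, so the jump can be moved and the lift is not isometric: the indicator functions of
  \<open>{b}\<close> and of \<open>[b-\<eta>,b]\<close> are at J1 distance \<open>1\<close> for \<open>\<eta> < b - a\<close>, but such lifts of them are at
  distance at most \<open>\<eta>\<close>.\<close>

definition trivial_lift ::
    "real \<Rightarrow> real \<Rightarrow> (real \<Rightarrow> 'a::real_normed_vector) \<Rightarrow>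
      ((real \<Rightarrow> real \<Rightarrow> 'a) \<times> real set) set" where
  "trivial_lift a b h = alpha_rel a b `` {(trivial_path {a..b} h, {a})}"

end

theory Submission
  imports Defs
begin

text \<open>The limit in the definition of \<open>alpha\<close> hides a simpler description. Encode a decorated path
  as a cadlag path \<open>h\<close> on some parameter interval together with a clock \<open>m\<close>, a continuous
  nondecreasing map of the parameters onto \<open>[a,b]\<close> which rests at each marked time while \<open>h\<close> runs
  through the excursion attached to it. Declare two such timed paths to be within \<open>r\<close> of each
  other if, after an increasing change of parameter, both clocks and both positions differ by at
  most \<open>r\<close> (\<open>matches\<close>). Then \<open>alpha\<close> is the infimum of these \<open>r\<close> (\<open>alpha_eq_Inf_matches\<close>): the
  \<open>\<delta>\<close>-extension is one timed path for \<open>(\<phi>, P)\<close>, its clock is within \<open>\<delta>\<close> of the identity, and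
  comparing with identity clocks is the J1 distance (\<open>delta_extension_presents\<close>); timed paths for
  the same decorated path differ by a change of parameter only (\<open>presents_unique\<close>). In particular
  the limit exists and \<open>alpha\<close> is a pseudometric.

  Conversely every timed path comes from a decorated path, up to distance zero
  (\<open>prolong_presents_exists\<close>, \<open>matches_prolong\<close>): cut \<open>h\<close> along the fibres of the clock. This gives
  completeness. For a rapidly converging sequence of timed paths the changes of parameter compose,
  clocks and paths converge uniformly on a common parameter interval, and the limit is again a
  timed path (\<open>fast_decorated_sequence_limit\<close>).

  A cadlag path with the identity clock is a timed path for its trivial lift, except for an initial
  rest which is invisible by right continuity. So the lift is isometric (\<open>alpha_trivial_path\<close>). For
  small \<open>\<delta>\<close> the clock of a \<open>\<delta>\<close>-extension is close to the identity, so the path may as well be read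
  with the identity clock; hence the lifts are dense (\<open>trivial_path_dense\<close>).\<close>

section \<open>Cadlag functions\<close>

text \<open>A jump of a monotone function would leave a gap in its image. This makes continuity of every change
of parameter and of every clock below automatic.\<close>

lemma mono_on_surj_continuous_on:
  fixes f :: "real \<Rightarrow> real"
  assumes mono: "mono_on S f" and surj: "f ` S = {p..q}"
  shows "continuous_on S f"
  unfolding continuous_on_def
proof (intro ballI order_tendstoI)
  fix t y assume t: "t \<in> S" and y: "y < f t"
  show "\<forall>\<^sub>F x in at t within S. y < f x"
  proof (cases "\<forall>x\<in>S. y < f x")
    case True
    then show ?thesis by (auto simp: eventually_at_filter)
  next
    case False
    then obtain x0 where x0: "x0 \<in> S" "f x0 \<le> y" by auto
    have "f x0 \<in> {p..q}" "f t \<in> {p..q}" using surj x0 t by blast+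
    then have "(y + f t) / 2 \<in> f ` S" using surj x0 y by auto
    then obtain s where s: "s \<in> S" "f s = (y + f t) / 2" by force
    have "s < t"
      using mono_onD[OF mono t s(1)] s y by (cases "t \<le> s") auto
    have "\<forall>\<^sub>F x in at t within S. s < x"
      using \<open>s < t\<close> order_tendstoD(1)[OF tendsto_ident_at] by blast
    moreover have "\<forall>\<^sub>F x in at t within S. x \<in> S" by (simp add: eventually_at_filter)
    ultimately show ?thesis
    proof eventually_elim
      case (elim x)
      then have "f s \<le> f x" using mono_onD[OF mono s(1)] by auto
      then show ?case using s y by simp
    qed
  qed
next
  fix t y assume t: "t \<in> S" and y: "f t < y"
  show "\<forall>\<^sub>F x in at t within S. f x < y"
  proof (cases "\<forall>x\<in>S. f x < y")
    case True
    then show ?thesis by (auto simp: eventually_at_filter)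
  next
    case False
    then obtain x0 where x0: "x0 \<in> S" "y \<le> f x0" by force
    have "f x0 \<in> {p..q}" "f t \<in> {p..q}" using surj x0 t by blast+
    then have "(y + f t) / 2 \<in> f ` S" using surj x0 y by auto
    then obtain s where s: "s \<in> S" "f s = (y + f t) / 2" by force
    have "t < s"
      using mono_onD[OF mono s(1) t] s y by (cases "s \<le> t") auto
    have "\<forall>\<^sub>F x in at t within S. x < s"
      using \<open>t < s\<close> order_tendstoD(2)[OF tendsto_ident_at] by blast
    moreover have "\<forall>\<^sub>F x in at t within S. x \<in> S" by (simp add: eventually_at_filter)
    ultimately show ?thesis
    proof eventually_elim
      case (elim x)
      then have "f x \<le> f s" using mono_onD[OF mono _ s(1)] by auto
      then show ?case using s y by simp
    qed
  qed
qed

lemma cadlag_on_cong: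
  assumes "\<And>t. t \<in> I \<Longrightarrow> f t = g t"
  shows "cadlag_on I f \<longleftrightarrow> cadlag_on I g"
proof -
  have "(f \<longlongrightarrow> l) (at t within I \<inter> A) \<longleftrightarrow> (g \<longlongrightarrow> l) (at t within I \<inter> A)" for l t A
    using assms by (intro Lim_cong_within) auto
  then show ?thesis using assms by (simp add: cadlag_on_def)
qed

text \<open>On either side of a point a continuous monotone \<open>\<theta>\<close> is either locally constant, or approaches its
value strictly from the same side; in both cases the one-sided limits of \<open>h\<close> are passed on.\<close>

lemma cadlag_on_compose_mono:
  fixes h :: "real \<Rightarrow> 'a::topological_space"
  assumes h: "cadlag_on J h" and mono: "mono_on K \<theta>" and cont: "continuous_on K \<theta>"
    and sub: "\<theta> ` K \<subseteq> J"
  shows "cadlag_on K (\<lambda>u. h (\<theta> u))"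
  unfolding cadlag_on_def
proof (intro ballI conjI)
  fix t assume t: "t \<in> K"
  have \<theta>t: "\<theta> t \<in> J" using t sub by auto
  have lim: "(\<theta> \<longlongrightarrow> \<theta> t) (at t within K \<inter> A)" for A
    using cont t by (meson Int_lower1 continuous_on_def tendsto_within_subset)
  show "((\<lambda>u. h (\<theta> u)) \<longlongrightarrow> h (\<theta> t)) (at t within K \<inter> {t<..})"
  proof (cases "\<exists>v\<in>K. v > t \<and> \<theta> v = \<theta> t")
    case True
    then obtain v where v: "v \<in> K" "v > t" "\<theta> v = \<theta> t" by auto
    have "\<forall>\<^sub>F x in at t within K \<inter> {t<..}. x < v"
      using \<open>t < v\<close> order_tendstoD(2)[OF tendsto_ident_at] by blast
    moreover have "\<forall>\<^sub>F x in at t within K \<inter> {t<..}. x \<in> K \<inter> {t<..}"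
      by (simp add: eventually_at_filter)
    ultimately have "\<forall>\<^sub>F x in at t within K \<inter> {t<..}. h (\<theta> x) = h (\<theta> t)"
    proof eventually_elim
      case (elim x)
      then have "\<theta> t \<le> \<theta> x"
        using t v(1) by (intro mono_onD[OF mono]) simp_all
      moreover have "\<theta> x \<le> \<theta> v"
        using t v(1) elim by (intro mono_onD[OF mono]) simp_all
      ultimately show ?case using v by simp
    qed
    then show ?thesis by (rule tendsto_eventually)
  next
    case False
    have "\<forall>\<^sub>F x in at t within K \<inter> {t<..}. x \<in> K \<inter> {t<..}"
      by (simp add: eventually_at_filter)
    then have "\<forall>\<^sub>F x in at t within K \<inter> {t<..}. \<theta> x \<in> J \<inter> {\<theta> t<..} \<and> \<theta> x \<noteq> \<theta> t"
    proof eventually_elim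
      case (elim x)
      then have "\<theta> t \<le> \<theta> x" using mono_onD[OF mono] t by auto
      then show ?case using False elim sub by force
    qed
    then have "filterlim \<theta> (at (\<theta> t) within J \<inter> {\<theta> t<..}) (at t within K \<inter> {t<..})"
      using lim by (simp add: filterlim_at)
    moreover have "(h \<longlongrightarrow> h (\<theta> t)) (at (\<theta> t) within J \<inter> {\<theta> t<..})"
      using h \<theta>t by (simp add: cadlag_on_def)
    ultimately show ?thesis by (rule filterlim_compose[rotated])
  qed
  show "\<exists>l. ((\<lambda>u. h (\<theta> u)) \<longlongrightarrow> l) (at t within K \<inter> {..<t})"
  proof (cases "\<exists>v\<in>K. v < t \<and> \<theta> v = \<theta> t")
    case True
    then obtain v where v: "v \<in> K" "v < t" "\<theta> v = \<theta> t" by auto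
    have "\<forall>\<^sub>F x in at t within K \<inter> {..<t}. v < x"
      using \<open>v < t\<close> order_tendstoD(1)[OF tendsto_ident_at] by blast
    moreover have "\<forall>\<^sub>F x in at t within K \<inter> {..<t}. x \<in> K \<inter> {..<t}"
      by (simp add: eventually_at_filter)
    ultimately have "\<forall>\<^sub>F x in at t within K \<inter> {..<t}. h (\<theta> x) = h (\<theta> t)"
    proof eventually_elim
      case (elim x)
      then have "\<theta> v \<le> \<theta> x"
        using t v(1) by (intro mono_onD[OF mono]) simp_all
      moreover have "\<theta> x \<le> \<theta> t"
        using t v(1) elim by (intro mono_onD[OF mono]) simp_all
      ultimately show ?case using v by simp
    qed
    then show ?thesis by (intro exI[of _ "h (\<theta> t)"] tendsto_eventually)
  next
    case False
    have "\<forall>\<^sub>F x in at t within K \<inter> {..<t}. x \<in> K \<inter> {..<t}"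
      by (simp add: eventually_at_filter)
    then have "\<forall>\<^sub>F x in at t within K \<inter> {..<t}. \<theta> x \<in> J \<inter> {..<\<theta> t} \<and> \<theta> x \<noteq> \<theta> t"
    proof eventually_elim
      case (elim x)
      then have "\<theta> x \<le> \<theta> t" using mono_onD[OF mono] t by auto
      then show ?case using False elim sub by force
    qed
    then have *: "filterlim \<theta> (at (\<theta> t) within J \<inter> {..<\<theta> t}) (at t within K \<inter> {..<t})"
      using lim by (simp add: filterlim_at)
    obtain l where "(h \<longlongrightarrow> l) (at (\<theta> t) within J \<inter> {..<\<theta> t})"
      using h \<theta>t by (auto simp: cadlag_on_def)
    from filterlim_compose[OF this *] show ?thesis by blast
  qed
qed

lemma eventually_at_left_within_iff:
  fixes t :: real
  shows "eventually Q (at t within S \<inter> {..<t}) \<longleftrightarrow> (\<exists>\<eta>>0. \<forall>x\<in>S. t - \<eta> < x \<and> x < t \<longrightarrow> Q x)"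
  unfolding eventually_at by (intro ex_cong conj_cong refl) (auto simp: dist_real_def)

lemma eventually_at_right_within_iff:
  fixes t :: real
  shows "eventually Q (at t within S \<inter> {t<..}) \<longleftrightarrow> (\<exists>\<eta>>0. \<forall>x\<in>S. t < x \<and> x < t + \<eta> \<longrightarrow> Q x)"
  unfolding eventually_at by (intro ex_cong conj_cong refl) (auto simp: dist_real_def)

lemma cadlag_on_small_oscillation:
  fixes h :: "real \<Rightarrow> 'a::real_normed_vector"
  assumes h: "cadlag_on I h" and t: "t \<in> I" and "\<epsilon> > 0"
  obtains \<eta> where "\<eta> > 0"
    "\<And>x y. \<lbrakk>x \<in> I; y \<in> I; t - \<eta> < x; x < t; t - \<eta> < y; y < t\<rbrakk> \<Longrightarrow> norm (h x - h y) < \<epsilon>"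
    "\<And>x y. \<lbrakk>x \<in> I; y \<in> I; t \<le> x; x < t + \<eta>; t \<le> y; y < t + \<eta>\<rbrakk> \<Longrightarrow> norm (h x - h y) < \<epsilon>"
proof -
  obtain l where l: "(h \<longlongrightarrow> l) (at t within I \<inter> {..<t})"
    and r: "(h \<longlongrightarrow> h t) (at t within I \<inter> {t<..})"
    using h t by (auto simp: cadlag_on_def)
  obtain \<eta>1 where 1: "\<eta>1 > 0" "\<forall>x\<in>I. t - \<eta>1 < x \<and> x < t \<longrightarrow> dist (h x) l < \<epsilon>/2"
    using tendstoD[OF l, of "\<epsilon>/2"] \<open>\<epsilon> > 0\<close> unfolding eventually_at_left_within_iff by auto
  obtain \<eta>2 where 2: "\<eta>2 > 0" "\<forall>x\<in>I. t < x \<and> x < t + \<eta>2 \<longrightarrow> dist (h x) (h t) < \<epsilon>/2"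
    using tendstoD[OF r, of "\<epsilon>/2"] \<open>\<epsilon> > 0\<close> unfolding eventually_at_right_within_iff by auto
  have half: "norm (h x - h y) < \<epsilon>" if "dist (h x) c < \<epsilon>/2" "dist (h y) c < \<epsilon>/2" for x y c
    using dist_triangle_half_l[OF that] by (simp add: dist_norm)
  have R: "dist (h x) (h t) < \<epsilon>/2" if "x\<in>I" "t \<le> x" "x < t + \<eta>2" for x
    using 2 that \<open>\<epsilon> > 0\<close> by (cases "x = t") auto
  show ?thesis
  proof (rule that[of "min \<eta>1 \<eta>2"])
    show "min \<eta>1 \<eta>2 > 0" using 1 2 by simp
  next
    fix x y assume "x \<in> I" "y \<in> I" "t - min \<eta>1 \<eta>2 < x" "x < t" "t - min \<eta>1 \<eta>2 < y" "y < t"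
    with 1 show "norm (h x - h y) < \<epsilon>" by (intro half[of x l y]) auto
  next
    fix x y assume "x \<in> I" "y \<in> I" "t \<le> x" "x < t + min \<eta>1 \<eta>2" "t \<le> y" "y < t + min \<eta>1 \<eta>2"
    with R show "norm (h x - h y) < \<epsilon>" by (intro half[of x "h t" y]) auto
  qed
qed

lemma compact_gauge_cover:
  assumes "compact I" and "\<And>t. t \<in> I \<Longrightarrow> \<eta> t > 0"
  obtains C where "C \<subseteq> I" "finite C" "I \<subseteq> (\<Union>c\<in>C. ball c (\<eta> c))"
proof (rule compactE_image[OF assms(1)])
  show "I \<subseteq> (\<Union>c\<in>I. ball c (\<eta> c))" using assms(2) by fastforce
qed auto

text \<open>Around each point of a compact set there is a ball whose two halves carry small oscillation. The
centres and ends of finitely many such balls form the set \<open>E\<close>: an interval that avoids them lies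
inside one half. Disjoint intervals on which \<open>h\<close> oscillates by at least \<open>\<epsilon>\<close> must each meet \<open>E\<close>,
so there are only finitely many of them.\<close>

lemma cadlag_on_oscillation_cover:
  fixes h :: "real \<Rightarrow> 'a::real_normed_vector"
  assumes h: "cadlag_on I h" and "compact I" and "\<epsilon> > 0"
  obtains E where "finite E"
    "\<And>x y. \<lbrakk>{x..y} \<subseteq> I; x \<le> y; {x..y} \<inter> E = {}\<rbrakk> \<Longrightarrow> norm (h x - h y) < \<epsilon>"
proof -
  define near where "near t \<eta> x y \<longleftrightarrow>
    t - \<eta> < x \<and> x < t \<and> t - \<eta> < y \<and> y < t \<or> t \<le> x \<and> x < t + \<eta> \<and> t \<le> y \<and> y < t + \<eta>"
    for t \<eta> x y :: real
  have "\<exists>\<eta>>0. \<forall>x\<in>I. \<forall>y\<in>I. near t \<eta> x y \<longrightarrow> norm (h x - h y) < \<epsilon>" if t: "t \<in> I" for t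
    using cadlag_on_small_oscillation[OF h t \<open>\<epsilon> > 0\<close>] unfolding near_def by (smt (verit))
  then obtain \<eta> where \<eta>: "\<And>t. t \<in> I \<Longrightarrow> \<eta> t > 0"
    and near: "\<And>t x y. \<lbrakk>t \<in> I; x \<in> I; y \<in> I; near t (\<eta> t) x y\<rbrakk> \<Longrightarrow> norm (h x - h y) < \<epsilon>"
    by metis
  obtain C where C: "C \<subseteq> I" "finite C" "I \<subseteq> (\<Union>c\<in>C. ball c (\<eta> c))"
    using compact_gauge_cover[OF \<open>compact I\<close>, of \<eta>] \<eta> by blast
  show ?thesis
  proof (rule that[of "C \<union> (\<lambda>c. c - \<eta> c) ` C \<union> (\<lambda>c. c + \<eta> c) ` C"])
    show "finite (C \<union> (\<lambda>c. c - \<eta> c) ` C \<union> (\<lambda>c. c + \<eta> c) ` C)" using C by simp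
    fix x y assume xy: "{x..y} \<subseteq> I" "x \<le> y"
      and dis: "{x..y} \<inter> (C \<union> (\<lambda>c. c - \<eta> c) ` C \<union> (\<lambda>c. c + \<eta> c) ` C) = {}"
    have mem: "x \<in> I" "y \<in> I" using xy by auto
    then obtain c where c: "c \<in> C" "x \<in> ball c (\<eta> c)" using C by blast
    have out: "c \<notin> {x..y}" "c - \<eta> c \<notin> {x..y}" "c + \<eta> c \<notin> {x..y}" using dis c by blast+
    have "c \<in> I" using c C by auto
    show "norm (h x - h y) < \<epsilon>"
      using out c xy by (intro near[OF \<open>c \<in> I\<close> mem]) (auto simp: near_def dist_real_def)
  qed
qed

lemma cadlag_on_bounded:
  fixes h :: "real \<Rightarrow> 'a::real_normed_vector"
  assumes h: "cadlag_on I h" and "compact I"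
  shows "bounded (h ` I)"
proof -
  have "\<forall>t\<in>I. \<exists>\<eta>>0. bounded (h ` (I \<inter> ball t \<eta>))"
  proof
    fix t assume t: "t \<in> I"
    obtain \<eta> where \<eta>: "\<eta> > 0"
      "\<And>x y. \<lbrakk>x \<in> I; y \<in> I; t - \<eta> < x; x < t; t - \<eta> < y; y < t\<rbrakk> \<Longrightarrow> norm (h x - h y) < 1"
      "\<And>x y. \<lbrakk>x \<in> I; y \<in> I; t \<le> x; x < t + \<eta>; t \<le> y; y < t + \<eta>\<rbrakk> \<Longrightarrow> norm (h x - h y) < 1"
      by (rule cadlag_on_small_oscillation[OF h t zero_less_one]) blast
    have local: "bounded (h ` A)" if "\<And>x y. x \<in> A \<Longrightarrow> y \<in> A \<Longrightarrow> norm (h x - h y) < 1" for A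
    proof (cases "A = {}")
      case False
      then obtain y where "y \<in> A" by auto
      then have "h ` A \<subseteq> cball (h y) 1" using that by (fastforce simp: dist_norm)
      then show ?thesis using bounded_cball bounded_subset by blast
    qed simp
    have "bounded (h ` (I \<inter> {t-\<eta><..<t}))" "bounded (h ` (I \<inter> {t..<t+\<eta>}))"
      using \<eta> by (auto intro!: local)
    then have "bounded (h ` (I \<inter> {t-\<eta><..<t}) \<union> h ` (I \<inter> {t..<t+\<eta>}))" by simp
    moreover have "h ` (I \<inter> ball t \<eta>) \<subseteq> h ` (I \<inter> {t-\<eta><..<t}) \<union> h ` (I \<inter> {t..<t+\<eta>})"
      by (force simp: dist_real_def)
    ultimately show "\<exists>\<eta>>0. bounded (h ` (I \<inter> ball t \<eta>))"
      using \<eta>(1) bounded_subset by blast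
  qed
  then obtain \<eta> where \<eta>: "\<And>t. t \<in> I \<Longrightarrow> \<eta> t > 0 \<and> bounded (h ` (I \<inter> ball t (\<eta> t)))" by metis
  obtain C where C: "C \<subseteq> I" "finite C" "I \<subseteq> (\<Union>c\<in>C. ball c (\<eta> c))"
    using compact_gauge_cover[OF \<open>compact I\<close>, of \<eta>] \<eta> by blast
  have "bounded (\<Union>c\<in>C. h ` (I \<inter> ball c (\<eta> c)))" using C \<eta> by auto
  moreover have "h ` I \<subseteq> (\<Union>c\<in>C. h ` (I \<inter> ball c (\<eta> c)))" using C by blast
  ultimately show ?thesis using bounded_subset by blast
qed

lemma cadlag_on_uniform_limit:
  fixes h :: "real \<Rightarrow> 'a::banach"
  assumes f: "\<And>n. cadlag_on I (f n)" and lim: "uniform_limit I f h sequentially"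
  shows "cadlag_on I h"
  unfolding cadlag_on_def
proof (intro ballI conjI)
  fix t assume t: "t \<in> I"
  have lim': "uniform_limit (I \<inter> A) f h sequentially" for A
    by (rule uniform_limit_on_subset[OF lim]) auto
  show "(h \<longlongrightarrow> h t) (at t within I \<inter> {t<..})"
    using f t
    by (intro swap_uniform_limit[OF always_eventually tendsto_uniform_limitI[OF lim t] lim'])
      (auto simp: cadlag_on_def)
  have "\<forall>n. \<exists>l. (f n \<longlongrightarrow> l) (at t within I \<inter> {..<t})" using f t by (auto simp: cadlag_on_def)
  then obtain l where l: "\<And>n. (f n \<longlongrightarrow> l n) (at t within I \<inter> {..<t})" by metis
  show "\<exists>l. (h \<longlongrightarrow> l) (at t within I \<inter> {..<t})"
  proof (cases "at t within I \<inter> {..<t} = bot")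
    case False
    have "Cauchy l"
    proof (rule metric_CauchyI)
      fix e :: real assume "e > 0"
      then obtain N where N: "\<And>n x. n \<ge> N \<Longrightarrow> x \<in> I \<Longrightarrow> dist (f n x) (h x) < e/4"
        using lim unfolding uniform_limit_iff eventually_sequentially
        by (metis zero_less_divide_iff zero_less_numeral)
      have "dist (l m) (l n) < e" if "m \<ge> N" "n \<ge> N" for m n
      proof -
        have "dist (l m) (l n) \<le> e/2"
        proof (rule tendsto_upperbound[OF tendsto_dist[OF l l] _ False])
          show "\<forall>\<^sub>F x in at t within I \<inter> {..<t}. dist (f m x) (f n x) \<le> e / 2"
            unfolding eventually_at_filter
          proof (intro always_eventually allI impI)
            fix x assume "x \<in> I \<inter> {..<t}"
            then show "dist (f m x) (f n x) \<le> e / 2"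
              using N[OF that(1), of x] N[OF that(2), of x] dist_triangle2[of "f m x" "f n x" "h x"]
              by simp
          qed
        qed
        then show ?thesis using \<open>e > 0\<close> by linarith
      qed
      then show "\<exists>M. \<forall>m\<ge>M. \<forall>n\<ge>M. dist (l m) (l n) < e" by blast
    qed
    then obtain L where "l \<longlonglongrightarrow> L" using Cauchy_convergent convergent_def by blast
    then have "(h \<longlongrightarrow> L) (at t within I \<inter> {..<t})"
      by (intro swap_uniform_limit[OF always_eventually _ lim']) (auto simp: l)
    then show ?thesis ..
  qed auto
qed

section \<open>Matching timed paths\<close>

text \<open>A timed path is a triple \<open>(d, m, h)\<close>: a path \<open>h\<close> on the parameter interval \<open>{a..d}\<close> together
  with a clock \<open>m\<close>, which says at which time of \<open>{a..b}\<close> each parameter is visited. The relation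
  below compares clocks and positions up to a change of parameter. Keeping the bound \<open>r\<close> as an
  argument avoids infima until the very end, and makes the triangle inequality a composition. The
  J1 distance is the case of the identity clock.\<close>

definition matches ::
    "real \<Rightarrow> real \<Rightarrow> real \<times> (real \<Rightarrow> real) \<times> (real \<Rightarrow> 'a::real_normed_vector) \<Rightarrow>
      real \<times> (real \<Rightarrow> real) \<times> (real \<Rightarrow> 'a) \<Rightarrow> bool" where
  "matches a r = (\<lambda>(d1, m1, h1) (d2, m2, h2).
     \<exists>\<rho>. strict_mono_on {a..d2} \<rho> \<and> \<rho> ` {a..d2} = {a..d1} \<and>
        (\<forall>u\<in>{a..d2}. \<bar>m1 (\<rho> u) - m2 u\<bar> \<le> r \<and> norm (h1 (\<rho> u) - h2 u) \<le> r))"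

lemma matchesI:
  assumes "strict_mono_on {a..d2} \<rho>" and "\<rho> ` {a..d2} = {a..d1}"
    and "\<And>u. u \<in> {a..d2} \<Longrightarrow> \<bar>m1 (\<rho> u) - m2 u\<bar> \<le> r"
    and "\<And>u. u \<in> {a..d2} \<Longrightarrow> norm (h1 (\<rho> u) - h2 u) \<le> r"
  shows "matches a r (d1, m1, h1) (d2, m2, h2)"
  unfolding matches_def using assms by blast

lemma matchesE:
  assumes "matches a r (d1, m1, h1) (d2, m2, h2)"
  obtains \<rho> where "strict_mono_on {a..d2} \<rho>" and "\<rho> ` {a..d2} = {a..d1}"
    and "\<And>u. u \<in> {a..d2} \<Longrightarrow> \<bar>m1 (\<rho> u) - m2 u\<bar> \<le> r"
    and "\<And>u. u \<in> {a..d2} \<Longrightarrow> norm (h1 (\<rho> u) - h2 u) \<le> r"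
  using assms unfolding matches_def by blast

lemma matches_mono: "matches a r X Y \<Longrightarrow> r \<le> s \<Longrightarrow> matches a s X Y"
  unfolding matches_def by (fastforce split: prod.splits)

lemma matches_refl: "0 \<le> r \<Longrightarrow> matches a r X X"
  by (cases X) (auto intro!: matchesI[of _ _ "\<lambda>u. u"] simp: strict_mono_on_def)

lemma matches_nonneg:
  assumes "matches a r X (d, m, h)" and "a \<le> d"
  shows "0 \<le> r"
proof (cases X)
  case (fields d1 m1 h1)
  then show ?thesis
    using assms by (auto elim!: matchesE dest!: meta_spec[of _ a])
qed

lemma strict_mono_on_inv_into:
  fixes \<rho> :: "real \<Rightarrow> real"
  assumes "strict_mono_on S \<rho>"
  shows "strict_mono_on (\<rho> ` S) (inv_into S \<rho>)"
proof (rule strict_mono_onI)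
  fix u v assume uv: "u \<in> \<rho> ` S" "v \<in> \<rho> ` S" "u < v"
  show "inv_into S \<rho> u < inv_into S \<rho> v"
    using uv strict_mono_on_leD[OF assms inv_into_into[OF uv(2)] inv_into_into[OF uv(1)]]
      f_inv_into_f[OF uv(1)] f_inv_into_f[OF uv(2)]
    by (cases "inv_into S \<rho> v \<le> inv_into S \<rho> u") auto
qed

lemma matches_sym:
  assumes "matches a r X Y"
  shows "matches a r Y X"
proof (cases X; cases Y)
  fix d1 m1 h1 d2 m2 h2 assume X: "X = (d1, m1, h1)" and Y: "Y = (d2, m2, h2)"
  from assms[unfolded X Y] show ?thesis
  proof (rule matchesE)
    fix \<rho> assume mono: "strict_mono_on {a..d2} \<rho>" and im: "\<rho> ` {a..d2} = {a..d1}"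
      and *: "\<And>u. u \<in> {a..d2} \<Longrightarrow> \<bar>m1 (\<rho> u) - m2 u\<bar> \<le> r"
        "\<And>u. u \<in> {a..d2} \<Longrightarrow> norm (h1 (\<rho> u) - h2 u) \<le> r"
    define \<sigma> where "\<sigma> = inv_into {a..d2} \<rho>"
    have \<sigma>: "\<sigma> u \<in> {a..d2}" "\<rho> (\<sigma> u) = u" if "u \<in> {a..d1}" for u
      using that im unfolding \<sigma>_def by (metis inv_into_into, metis f_inv_into_f)
    have "matches a r (d2, m2, h2) (d1, m1, h1)"
    proof (rule matchesI[of _ _ \<sigma>])
      show "strict_mono_on {a..d1} \<sigma>"
        using strict_mono_on_inv_into[OF mono] by (simp add: im \<sigma>_def)
      show "\<sigma> ` {a..d1} = {a..d2}"
        using inj_on_image_eq_iff strict_mono_on_imp_inj_on[OF mono]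
        unfolding \<sigma>_def im[symmetric] by (auto simp: image_image)
      show "\<bar>m2 (\<sigma> u) - m1 u\<bar> \<le> r" if "u \<in> {a..d1}" for u
        using *(1)[OF \<sigma>(1)[OF that]] \<sigma>(2)[OF that] by (simp add: abs_minus_commute)
      show "norm (h2 (\<sigma> u) - h1 u) \<le> r" if "u \<in> {a..d1}" for u
        using *(2)[OF \<sigma>(1)[OF that]] \<sigma>(2)[OF that] by (simp add: norm_minus_commute)
    qed
    then show ?thesis by (simp add: X Y)
  qed
qed

lemma matches_trans:
  assumes "matches a r X Y" and "matches a s Y Z"
  shows "matches a (r + s) X Z"
proof (cases X; cases Y; cases Z)
  fix d1 m1 h1 d2 m2 h2 d3 m3 h3
  assume X: "X = (d1, m1, h1)" and Y: "Y = (d2, m2, h2)" and Z: "Z = (d3, m3, h3)"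
  from assms(1)[unfolded X Y] obtain \<rho>
    where \<rho>: "strict_mono_on {a..d2} \<rho>" "\<rho> ` {a..d2} = {a..d1}"
      "\<And>u. u \<in> {a..d2} \<Longrightarrow> \<bar>m1 (\<rho> u) - m2 u\<bar> \<le> r"
      "\<And>u. u \<in> {a..d2} \<Longrightarrow> norm (h1 (\<rho> u) - h2 u) \<le> r"
    by (rule matchesE) blast
  from assms(2)[unfolded Y Z] obtain \<sigma>
    where \<sigma>: "strict_mono_on {a..d3} \<sigma>" "\<sigma> ` {a..d3} = {a..d2}"
      "\<And>u. u \<in> {a..d3} \<Longrightarrow> \<bar>m2 (\<sigma> u) - m3 u\<bar> \<le> s"
      "\<And>u. u \<in> {a..d3} \<Longrightarrow> norm (h2 (\<sigma> u) - h3 u) \<le> s"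
    by (rule matchesE) blast
  have in2: "\<sigma> u \<in> {a..d2}" if "u \<in> {a..d3}" for u using \<sigma>(2) that by blast
  have "matches a (r + s) (d1, m1, h1) (d3, m3, h3)"
  proof (rule matchesI[of _ _ "\<lambda>u. \<rho> (\<sigma> u)"])
    show "strict_mono_on {a..d3} (\<lambda>u. \<rho> (\<sigma> u))"
      using \<rho>(1) \<sigma>(1) in2 by (simp add: strict_mono_on_def)
    show "(\<lambda>u. \<rho> (\<sigma> u)) ` {a..d3} = {a..d1}"
      using \<rho>(2) \<sigma>(2) image_image[of \<rho> \<sigma> "{a..d3}"] by simp
    fix u assume u: "u \<in> {a..d3}"
    show "\<bar>m1 (\<rho> (\<sigma> u)) - m3 u\<bar> \<le> r + s"
      using \<rho>(3)[OF in2[OF u]] \<sigma>(3)[OF u] by linarith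
    show "norm (h1 (\<rho> (\<sigma> u)) - h3 u) \<le> r + s"
      using norm_diff_triangle_le[OF \<rho>(4)[OF in2[OF u]] \<sigma>(4)[OF u]] .
  qed
  then show ?thesis by (simp add: X Z)
qed

text \<open>For the extension with parameter \<open>\<delta>\<close> the clock differs from the identity by at most \<open>\<delta>\<close>, so this
lemma compares the J1 distance of two extensions with the matching of their timed paths.\<close>

lemma matches_retime:
  assumes "matches a r (d1, m1, h1) (d2, m2, h2)"
    and "\<And>u. u \<in> {a..d1} \<Longrightarrow> \<bar>\<mu>1 u - m1 u\<bar> \<le> \<delta>"
    and "\<And>u. u \<in> {a..d2} \<Longrightarrow> \<bar>\<mu>2 u - m2 u\<bar> \<le> \<delta>" and "0 \<le> \<delta>"
  shows "matches a (r + 2 * \<delta>) (d1, \<mu>1, h1) (d2, \<mu>2, h2)"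
proof -
  from assms(1) obtain \<rho>
    where \<rho>: "strict_mono_on {a..d2} \<rho>" "\<rho> ` {a..d2} = {a..d1}"
      "\<And>u. u \<in> {a..d2} \<Longrightarrow> \<bar>m1 (\<rho> u) - m2 u\<bar> \<le> r"
      "\<And>u. u \<in> {a..d2} \<Longrightarrow> norm (h1 (\<rho> u) - h2 u) \<le> r"
    by (rule matchesE) blast
  show ?thesis
  proof (rule matchesI[OF \<rho>(1,2)])
    fix u assume u: "u \<in> {a..d2}"
    then have "\<rho> u \<in> {a..d1}" using \<rho>(2) by blast
    then show "\<bar>\<mu>1 (\<rho> u) - \<mu>2 u\<bar> \<le> r + 2 * \<delta>"
      using \<rho>(3)[OF u] assms(2)[of "\<rho> u"] assms(3)[OF u] by linarith
    show "norm (h1 (\<rho> u) - h2 u) \<le> r + 2 * \<delta>"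
      using \<rho>(4)[OF u] \<open>0 \<le> \<delta>\<close> by linarith
  qed
qed

section \<open>The J1 distance\<close>

lemma SUP_displacement_nonneg:
  fixes \<rho> :: "real \<Rightarrow> real"
  assumes "I \<noteq> {}" and bdd: "bdd_above ((\<lambda>x. \<bar>\<rho> x - x\<bar>) ` I)"
  shows "0 \<le> (SUP x\<in>I. \<bar>\<rho> x - x\<bar>)"
proof -
  obtain x where "x \<in> I" using \<open>I \<noteq> {}\<close> by blast
  from cSUP_upper[OF this bdd] show ?thesis by linarith
qed

lemma reparams_Icc_iff:
  "\<rho> \<in> reparams {a..d} \<longleftrightarrow> strict_mono_on {a..d} \<rho> \<and> \<rho> ` {a..d} = {a..d}"
  unfolding reparams_def
  by (auto simp: bij_betw_def intro: mono_on_surj_continuous_on strict_mono_on_imp_mono_on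
      strict_mono_on_imp_inj_on)

lemma reparam_displacement_bdd_above:
  assumes "\<rho> ` {a..d} = {a..d::real}"
  shows "bdd_above ((\<lambda>x. \<bar>\<rho> x - x\<bar>) ` {a..d})"
proof (rule bdd_aboveI2[of _ _ "d - a"])
  fix x assume x: "x \<in> {a..d}"
  then have "\<rho> x \<in> {a..d}" using assms by blast
  with x show "\<bar>\<rho> x - x\<bar> \<le> d - a" by auto
qed

lemma J1_dist_le:
  fixes h1 h2 :: "real \<Rightarrow> 'a::real_normed_vector"
  assumes m: "matches a r (d, \<lambda>u. u, h1) (d, \<lambda>u. u, h2)" and "a \<le> d"
  shows "J1_dist {a..d} h1 h2 \<le> r"
proof -
  from m obtain \<rho>
    where \<rho>: "strict_mono_on {a..d} \<rho>" "\<rho> ` {a..d} = {a..d}"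
      "\<And>u. u \<in> {a..d} \<Longrightarrow> \<bar>\<rho> u - u\<bar> \<le> r"
      "\<And>u. u \<in> {a..d} \<Longrightarrow> norm (h1 (\<rho> u) - h2 u) \<le> r"
    by (rule matchesE) blast
  have ne: "{a..d} \<noteq> {}" using \<open>a \<le> d\<close> by simp
  have "J1_dist {a..d} h1 h2 \<le> max (SUP x\<in>{a..d}. \<bar>\<rho> x - x\<bar>) (SUP x\<in>{a..d}. norm (h1 (\<rho> x) - h2 x))"
    unfolding J1_dist_def
  proof (rule cINF_lower)
    show "\<rho> \<in> reparams {a..d}" using \<rho> by (simp add: reparams_Icc_iff)
    show "bdd_below ((\<lambda>\<rho>. max (SUP x\<in>{a..d}. \<bar>\<rho> x - x\<bar>) (SUP x\<in>{a..d}. norm (h1 (\<rho> x) - h2 x)))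
       ` reparams {a..d})"
      by (rule bdd_belowI2[of _ 0])
        (auto simp: reparams_Icc_iff \<open>a \<le> d\<close> intro!: max.coboundedI1 SUP_displacement_nonneg
          reparam_displacement_bdd_above)
  qed
  also have "\<dots> \<le> r" using \<rho> ne by (auto intro!: cSUP_least)
  finally show ?thesis .
qed

lemma matches_if_J1_dist_less:
  fixes h1 h2 :: "real \<Rightarrow> 'a::real_normed_vector"
  assumes h: "bounded (h1 ` {a..d})" "bounded (h2 ` {a..d})"
    and less: "J1_dist {a..d} h1 h2 < r"
  shows "matches a r (d, \<lambda>u. u, h1) (d, \<lambda>u. u, h2)"
proof -
  have id: "(\<lambda>u. u) \<in> reparams {a..d}" by (simp add: reparams_Icc_iff strict_mono_on_def)
  obtain \<rho> where \<rho>: "\<rho> \<in> reparams {a..d}"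
    and lt: "max (SUP x\<in>{a..d}. \<bar>\<rho> x - x\<bar>) (SUP x\<in>{a..d}. norm (h1 (\<rho> x) - h2 x)) < r"
    using cInf_lessD[OF _ less[unfolded J1_dist_def]] id by blast
  have im: "\<rho> ` {a..d} = {a..d}" using \<rho> by (simp add: reparams_Icc_iff)
  obtain B1 B2 where B: "\<And>u. u \<in> {a..d} \<Longrightarrow> norm (h1 u) \<le> B1" "\<And>u. u \<in> {a..d} \<Longrightarrow> norm (h2 u) \<le> B2"
    using h unfolding bounded_iff by (metis imageI)
  have bdd: "bdd_above ((\<lambda>x. norm (h1 (\<rho> x) - h2 x)) ` {a..d})"
  proof (rule bdd_aboveI2[of _ _ "B1 + B2"])
    fix x assume x: "x \<in> {a..d}"
    then have "\<rho> x \<in> {a..d}" using im by blast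
    then show "norm (h1 (\<rho> x) - h2 x) \<le> B1 + B2"
      using B x by (intro norm_triangle_le_diff add_mono) auto
  qed
  show ?thesis
  proof (rule matchesI[of _ _ \<rho>])
    fix u assume u: "u \<in> {a..d}"
    show "\<bar>\<rho> u - u\<bar> \<le> r"
      using cSUP_upper[OF u reparam_displacement_bdd_above[OF im]] lt by simp
    show "norm (h1 (\<rho> u) - h2 u) \<le> r"
      using cSUP_upper[OF u bdd] lt by simp
  qed (use \<rho> in \<open>simp_all add: reparams_Icc_iff\<close>)
qed

section \<open>Prolonging at the left endpoint\<close>

text \<open>The path rests at its initial state for one unit before it starts. This creates a plateau of the
clock, so that the result corresponds to a decorated path whose set of marked times is not empty.
The plateau is put at the left endpoint because right continuity makes it negligible there; at the
right endpoint, where the path may jump, it would change the distance.\<close>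

definition prolong ::
    "real \<Rightarrow> real \<times> (real \<Rightarrow> real) \<times> (real \<Rightarrow> 'a) \<Rightarrow> real \<times> (real \<Rightarrow> real) \<times> (real \<Rightarrow> 'a)" where
  "prolong a = (\<lambda>(d, m, h). (d + 1, \<lambda>u. m (max a (u - 1)), \<lambda>u. h (max a (u - 1))))"

lemma continuous_on_imp_cadlag_on: "continuous_on I h \<Longrightarrow> cadlag_on I h"
  unfolding cadlag_on_def continuous_on_def by (meson Int_lower1 tendsto_within_subset)

text \<open>The parameter interval \<open>{a..a+c}\<close>, on which the path hardly moves, is stretched by the factor
\<open>(1 + c) / c\<close> so as to absorb the rest of length one; later parameters are only shifted.\<close>

lemma matches_prolong:
  assumes "a < d" and cont: "continuous_on {a..d} m" and h: "cadlag_on {a..d} h" and "r > 0"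
  shows "matches a r (prolong a (d, m, h)) (d, m, h)"
proof -
  have aI: "a \<in> {a..d}" using \<open>a < d\<close> by simp
  obtain \<eta>1 where \<eta>1: "\<eta>1 > 0"
    "\<And>x y. \<lbrakk>x \<in> {a..d}; y \<in> {a..d}; a \<le> x; x < a + \<eta>1; a \<le> y; y < a + \<eta>1\<rbrakk> \<Longrightarrow> norm (h x - h y) < r"
    by (rule cadlag_on_small_oscillation[OF h aI \<open>r > 0\<close>]) blast
  obtain \<eta>2 where \<eta>2: "\<eta>2 > 0"
    "\<And>x y. \<lbrakk>x \<in> {a..d}; y \<in> {a..d}; a \<le> x; x < a + \<eta>2; a \<le> y; y < a + \<eta>2\<rbrakk> \<Longrightarrow> norm (m x - m y) < r"
    by (rule cadlag_on_small_oscillation[OF continuous_on_imp_cadlag_on[OF cont] aI \<open>r > 0\<close>]) blast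
  obtain c where c: "0 < c" "c < \<eta>1" "c < \<eta>2" "c < d - a"
    using dense[of 0 "min (min \<eta>1 \<eta>2) (d - a)"] \<eta>1(1) \<eta>2(1) \<open>a < d\<close> by auto
  define \<rho> where "\<rho> u = (if u \<le> a + c then a + (u - a) * ((1 + c) / c) else u + 1)" for u
  have slow: "(u - a) * ((1 + c) / c) \<le> 1 + c \<longleftrightarrow> u \<le> a + c" for u
  proof -
    have "(u - a) * ((1 + c) / c) = (1 + c) * ((u - a) / c)" by simp
    also have "\<dots> \<le> 1 + c \<longleftrightarrow> (u - a) / c \<le> 1"
      using c(1) by (simp only: mult_le_cancel_left2) auto
    also have "\<dots> \<longleftrightarrow> u \<le> a + c" using c(1) by (auto simp: field_simps)
    finally show ?thesis .
  qed
  have low: "\<rho> u \<in> {a..a + 1 + c}" if "u \<in> {a..a+c}" for u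
    using that slow[of u] c(1) by (simp add: \<rho>_def)
  have smono: "strict_mono_on {a..d} \<rho>"
  proof (rule strict_mono_onI)
    fix u v assume uv: "u \<in> {a..d}" "v \<in> {a..d}" "u < v"
    show "\<rho> u < \<rho> v"
    proof (cases "v \<le> a + c")
      case True
      have "(u - a) * ((1 + c) / c) < (v - a) * ((1 + c) / c)"
        using uv c(1) by (intro mult_strict_right_mono) auto
      then show ?thesis using uv True by (simp add: \<rho>_def)
    next
      case False
      then show ?thesis using low[of u] uv by (cases "u \<le> a + c") (auto simp: \<rho>_def)
    qed
  qed
  have im: "\<rho> ` {a..d} = {a..d + 1}"
  proof (intro equalityI subsetI)
    fix y assume "y \<in> \<rho> ` {a..d}"
    then show "y \<in> {a..d+1}" using low c by (force simp: \<rho>_def split: if_splits)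
  next
    fix y assume y: "y \<in> {a..d+1}"
    show "y \<in> \<rho> ` {a..d}"
    proof (cases "y \<le> a + 1 + c")
      case True
      have "\<rho> (a + (y - a) * (c / (1 + c))) = y"
        using c(1) slow[of "a + (y - a) * (c / (1 + c))"] True by (simp add: \<rho>_def)
      moreover have "a + (y - a) * (c / (1 + c)) \<in> {a..d}"
      proof -
        have "(y - a) * (c / (1 + c)) \<le> (1 + c) * (c / (1 + c))"
          using True c(1) by (intro mult_right_mono) auto
        then show ?thesis using y c by simp
      qed
      ultimately show ?thesis by (metis image_eqI)
    next
      case False
      then show ?thesis using y c by (intro image_eqI[of _ _ "y - 1"]) (auto simp: \<rho>_def)
    qed
  qed
  have shift: "max a (\<rho> u - 1) = u \<or> u \<in> {a..a+c} \<and> max a (\<rho> u - 1) \<in> {a..a+c}" if "u \<in> {a..d}" for u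
    using that low[of u] c by (cases "u \<le> a + c") (auto simp: \<rho>_def)
  show ?thesis unfolding prolong_def prod.case
  proof (rule matchesI[OF smono im])
    fix u assume "u \<in> {a..d}"
    from shift[OF this] show "\<bar>m (max a (\<rho> u - 1)) - m u\<bar> \<le> r"
    proof
      assume "u \<in> {a..a+c} \<and> max a (\<rho> u - 1) \<in> {a..a+c}"
      then have "norm (m (max a (\<rho> u - 1)) - m u) < r" using c by (intro \<eta>2(2)) auto
      then show ?thesis by simp
    qed (use \<open>r > 0\<close> in simp)
  next
    fix u assume "u \<in> {a..d}"
    from shift[OF this] show "norm (h (max a (\<rho> u - 1)) - h u) \<le> r"
    proof
      assume "u \<in> {a..a+c} \<and> max a (\<rho> u - 1) \<in> {a..a+c}"
      then have "norm (h (max a (\<rho> u - 1)) - h u) < r" using c by (intro \<eta>1(2)) auto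
      then show ?thesis by simp
    qed (use \<open>r > 0\<close> in simp)
  qed
qed

section \<open>Timed paths presenting a decorated path\<close>

text \<open>The extension of a decorated path with empty \<open>P\<close> stays constant on \<open>{b..b+\<delta>}\<close>, exactly as if the
stationary time \<open>b\<close> were marked.\<close>

definition marks :: "real \<Rightarrow> real set \<Rightarrow> real set" where
  "marks b P = (if P = {} then {b} else P)"

text \<open>The clock \<open>m\<close> rests precisely at the marked times, and during the rest \<open>{l t..r t}\<close> the path runs
through the excursion \<open>\<phi> t\<close> at constant speed. At an unmarked time \<open>l t = r t\<close>, and the formula for
\<open>h\<close> reads \<open>\<phi> t 0\<close> because \<open>0 / 0 = 0\<close>; as \<open>\<phi> t\<close> is then constant on \<open>{0..1}\<close>, this is \<open>\<phi> t 1\<close>.\<close>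

definition presents ::
    "real \<Rightarrow> real \<Rightarrow> (real \<Rightarrow> real \<Rightarrow> 'a) \<times> real set \<Rightarrow> real \<times> (real \<Rightarrow> real) \<times> (real \<Rightarrow> 'a) \<Rightarrow> bool" where
  "presents a b = (\<lambda>(\<phi>, P) (d, m, h). a < d \<and> mono_on {a..d} m \<and> m ` {a..d} = {a..b} \<and>
     (\<exists>l r. \<forall>t\<in>{a..b}. {u\<in>{a..d}. m u = t} = {l t..r t} \<and> (l t < r t \<longleftrightarrow> t \<in> marks b P) \<and>
        (\<forall>u\<in>{l t..r t}. h u = \<phi> t ((u - l t) / (r t - l t)))))"

lemma presentsI:
  assumes "a < d" "mono_on {a..d} m" "m ` {a..d} = {a..b}"
    and "\<And>t. t \<in> {a..b} \<Longrightarrow> {u\<in>{a..d}. m u = t} = {l t..r t}"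
    and "\<And>t. t \<in> {a..b} \<Longrightarrow> l t < r t \<longleftrightarrow> t \<in> marks b P"
    and "\<And>t u. t \<in> {a..b} \<Longrightarrow> u \<in> {l t..r t} \<Longrightarrow> h u = \<phi> t ((u - l t) / (r t - l t))"
  shows "presents a b (\<phi>, P) (d, m, h)"
  unfolding presents_def prod.case using assms by blast

lemma presentsE:
  assumes "presents a b (\<phi>, P) (d, m, h)"
  obtains l r where "a < d" "mono_on {a..d} m" "m ` {a..d} = {a..b}"
    and "\<And>t. t \<in> {a..b} \<Longrightarrow> {u\<in>{a..d}. m u = t} = {l t..r t}"
    and "\<And>t. t \<in> {a..b} \<Longrightarrow> l t \<le> r t"
    and "\<And>t. t \<in> {a..b} \<Longrightarrow> l t < r t \<longleftrightarrow> t \<in> marks b P"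
    and "\<And>t u. t \<in> {a..b} \<Longrightarrow> u \<in> {l t..r t} \<Longrightarrow> h u = \<phi> t ((u - l t) / (r t - l t))"
    and "\<And>u. u \<in> {a..d} \<Longrightarrow> m u \<in> {a..b}"
    and "\<And>u. u \<in> {a..d} \<Longrightarrow> u \<in> {l (m u)..r (m u)}"
proof -
  from assms obtain l r where *: "a < d" "mono_on {a..d} m" "m ` {a..d} = {a..b}"
    and fib: "\<And>t. t \<in> {a..b} \<Longrightarrow> {u\<in>{a..d}. m u = t} = {l t..r t}"
    and **: "\<And>t. t \<in> {a..b} \<Longrightarrow> l t < r t \<longleftrightarrow> t \<in> marks b P"
     "\<And>t u. t \<in> {a..b} \<Longrightarrow> u \<in> {l t..r t} \<Longrightarrow> h u = \<phi> t ((u - l t) / (r t - l t))"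
  proof -
    from assms have "a < d" "mono_on {a..d} m" "m ` {a..d} = {a..b}"
      and ex: "\<exists>l r. \<forall>t\<in>{a..b}. {u\<in>{a..d}. m u = t} = {l t..r t} \<and> (l t < r t \<longleftrightarrow> t \<in> marks b P) \<and>
        (\<forall>u\<in>{l t..r t}. h u = \<phi> t ((u - l t) / (r t - l t)))"
      unfolding presents_def prod.case by simp_all
    moreover from ex obtain l r where "\<forall>t\<in>{a..b}. {u\<in>{a..d}. m u = t} = {l t..r t} \<and>
        (l t < r t \<longleftrightarrow> t \<in> marks b P) \<and> (\<forall>u\<in>{l t..r t}. h u = \<phi> t ((u - l t) / (r t - l t)))"
      by (elim exE)
    ultimately show ?thesis by (intro that[of l r]) (simp_all del: atLeastAtMost_iff)
  qed
  have le: "l t \<le> r t" if t: "t \<in> {a..b}" for t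
  proof -
    obtain u where "u \<in> {a..d}" "m u = t" using t *(3) by (metis imageE)
    then have "u \<in> {l t..r t}" using fib[OF t] by blast
    then show ?thesis by simp
  qed
  have mI: "m u \<in> {a..b}" if "u \<in> {a..d}" for u using *(3) that by blast
  have lr: "u \<in> {l (m u)..r (m u)}" if "u \<in> {a..d}" for u using fib[OF mI[OF that]] that by blast
  show ?thesis using that[of l r] * fib le ** mI lr by blast
qed

text \<open>The excursion interval at a time in one presentation is mapped affinely onto the one in the
  other. Consequently nothing depends on how the rests are enumerated or how long they last.\<close>

lemma presents_unique:
  fixes \<phi> :: "real \<Rightarrow> real \<Rightarrow> 'a::real_normed_vector"
  assumes X: "presents a b (\<phi>, P) (d1, m1, h1)" and Y: "presents a b (\<phi>, P) (d2, m2, h2)"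
  shows "matches a 0 (d1, m1, h1) (d2, m2, h2)"
proof -
  obtain l r where 1: "a < d1" "mono_on {a..d1} m1" "m1 ` {a..d1} = {a..b}"
    and fib1: "\<And>t. t \<in> {a..b} \<Longrightarrow> {u\<in>{a..d1}. m1 u = t} = {l t..r t}"
    and le1: "\<And>t. t \<in> {a..b} \<Longrightarrow> l t \<le> r t"
    and mark1: "\<And>t. t \<in> {a..b} \<Longrightarrow> l t < r t \<longleftrightarrow> t \<in> marks b P"
    and h1: "\<And>t u. t \<in> {a..b} \<Longrightarrow> u \<in> {l t..r t} \<Longrightarrow> h1 u = \<phi> t ((u - l t) / (r t - l t))"
    and m1: "\<And>u. u \<in> {a..d1} \<Longrightarrow> m1 u \<in> {a..b}"
    and lr1: "\<And>u. u \<in> {a..d1} \<Longrightarrow> u \<in> {l (m1 u)..r (m1 u)}"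
    by (rule presentsE[OF X]) blast
  obtain l' r' where 2: "a < d2" "mono_on {a..d2} m2" "m2 ` {a..d2} = {a..b}"
    and fib2: "\<And>t. t \<in> {a..b} \<Longrightarrow> {u\<in>{a..d2}. m2 u = t} = {l' t..r' t}"
    and le2: "\<And>t. t \<in> {a..b} \<Longrightarrow> l' t \<le> r' t"
    and mark2: "\<And>t. t \<in> {a..b} \<Longrightarrow> l' t < r' t \<longleftrightarrow> t \<in> marks b P"
    and h2: "\<And>t u. t \<in> {a..b} \<Longrightarrow> u \<in> {l' t..r' t} \<Longrightarrow> h2 u = \<phi> t ((u - l' t) / (r' t - l' t))"
    and m2: "\<And>u. u \<in> {a..d2} \<Longrightarrow> m2 u \<in> {a..b}"
    and lr2: "\<And>u. u \<in> {a..d2} \<Longrightarrow> u \<in> {l' (m2 u)..r' (m2 u)}"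
    by (rule presentsE[OF Y]) blast
  define q where "q t u = l t + (u - l' t) / (r' t - l' t) * (r t - l t)" for t u
  define \<rho> where "\<rho> u = q (m2 u) u" for u
  have lr_eq: "l t = r t \<longleftrightarrow> l' t = r' t" if "t \<in> {a..b}" for t
    using le1[OF that] le2[OF that] mark1[OF that] mark2[OF that] by linarith
  have frac: "(u - l' t) / (r' t - l' t) \<in> {0..1}" if "t \<in> {a..b}" "u \<in> {l' t..r' t}" for t u
    using that by (auto simp: divide_le_eq_1)
  have q_in: "q t u \<in> {l t..r t}" if t: "t \<in> {a..b}" and u: "u \<in> {l' t..r' t}" for t u
  proof -
    have "(u - l' t) / (r' t - l' t) * (r t - l t) \<le> 1 * (r t - l t)"
      using frac[OF t u] le1[OF t] by (intro mult_right_mono) auto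
    moreover have "0 \<le> (u - l' t) / (r' t - l' t) * (r t - l t)"
      using frac[OF t u] le1[OF t] by (intro mult_nonneg_nonneg) auto
    ultimately show ?thesis by (simp add: q_def)
  qed
  have \<rho>_in: "\<rho> u \<in> {l (m2 u)..r (m2 u)}" if "u \<in> {a..d2}" for u
    unfolding \<rho>_def using q_in[OF m2[OF that] lr2[OF that]] .
  have \<rho>_dom: "\<rho> u \<in> {a..d1}" and m\<rho>: "m1 (\<rho> u) = m2 u" if "u \<in> {a..d2}" for u
    using \<rho>_in[OF that] fib1[OF m2[OF that]] by blast+
  have mono: "strict_mono_on {a..d2} \<rho>"
  proof (rule strict_mono_onI)
    fix u v assume uv: "u \<in> {a..d2}" "v \<in> {a..d2}" "u < v"
    have le: "m2 u \<le> m2 v" using mono_onD[OF 2(2) uv(1,2)] uv(3) by simp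
    show "\<rho> u < \<rho> v"
    proof (cases "m2 u = m2 v")
      case True
      define t where "t = m2 v"
      have t: "t \<in> {a..b}" using m2 uv t_def by simp
      have "l' t < r' t" using lr2[OF uv(1)] lr2[OF uv(2)] uv(3) True by (simp add: t_def)
      moreover have "l t < r t" using calculation mark1[OF t] mark2[OF t] by simp
      ultimately have "(u - l' t) / (r' t - l' t) * (r t - l t) < (v - l' t) / (r' t - l' t) * (r t - l t)"
        using uv by (intro mult_strict_right_mono divide_strict_right_mono) auto
      then show ?thesis by (simp add: \<rho>_def q_def True t_def)
    next
      case False
      show ?thesis
      proof (rule ccontr)
        assume "\<not> \<rho> u < \<rho> v"
        then have "m1 (\<rho> v) \<le> m1 (\<rho> u)" using uv \<rho>_dom by (intro mono_onD[OF 1(2)]) auto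
        then show False using False le m\<rho> uv by auto
      qed
    qed
  qed
  have surj: "\<rho> ` {a..d2} = {a..d1}"
  proof (intro equalityI subsetI)
    fix v assume v: "v \<in> {a..d1}"
    define t where "t = m1 v"
    have t: "t \<in> {a..b}" and vlr: "v \<in> {l t..r t}" using m1[OF v] lr1[OF v] by (auto simp: t_def)
    define u where "u = l' t + (v - l t) / (r t - l t) * (r' t - l' t)"
    have "0 \<le> (v - l t) / (r t - l t)" "(v - l t) / (r t - l t) \<le> 1"
      using vlr by (auto simp: divide_le_eq_1)
    then have "0 \<le> (v - l t) / (r t - l t) * (r' t - l' t)"
      and "(v - l t) / (r t - l t) * (r' t - l' t) \<le> 1 * (r' t - l' t)"
      using le2[OF t] by (intro mult_nonneg_nonneg mult_right_mono; simp)+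
    then have "u \<in> {l' t..r' t}" by (simp add: u_def)
    then have u: "u \<in> {a..d2}" "m2 u = t" using fib2[OF t] by blast+
    have "\<rho> u = q t u" by (simp add: \<rho>_def u(2))
    also have "\<dots> = v"
      using vlr lr_eq[OF t] by (cases "l t = r t") (auto simp: q_def u_def)
    finally have "\<rho> u = v" .
    then show "v \<in> \<rho> ` {a..d2}" using u by blast
  qed (use \<rho>_dom in auto)
  show ?thesis
  proof (rule matchesI[OF mono surj])
    fix u assume u: "u \<in> {a..d2}"
    show "\<bar>m1 (\<rho> u) - m2 u\<bar> \<le> 0" using m\<rho>[OF u] by simp
    have "(\<rho> u - l (m2 u)) / (r (m2 u) - l (m2 u)) = (u - l' (m2 u)) / (r' (m2 u) - l' (m2 u))"
      using lr_eq[OF m2[OF u]] by (cases "l (m2 u) = r (m2 u)") (auto simp: \<rho>_def q_def)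
    then show "norm (h1 (\<rho> u) - h2 u) \<le> 0"
      using h1[OF m2[OF u] \<rho>_in[OF u]] h2[OF m2[OF u] lr2[OF u]] by simp
  qed
qed

lemma decorated_pairsD:
  assumes "(\<phi>, P) \<in> decorated_pairs a b"
  shows "t \<in> {a..b} \<Longrightarrow> cadlag_on {0..1} (\<phi> t)"
    and "cadlag_on {a..b} (\<lambda>t. \<phi> t 1)"
    and "P \<subseteq> {a..b}" and "countable P"
    and "\<lbrakk>t \<in> {a..b}; t \<notin> P; s \<in> {0..1}; s' \<in> {0..1}\<rbrakk> \<Longrightarrow> \<phi> t s = \<phi> t s'"
    and "\<epsilon> > 0 \<Longrightarrow> finite {t\<in>P. (SUP s\<in>{0..1}. norm (\<phi> t s - \<phi> t 0)) > \<epsilon>}"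
proof -
  show "\<lbrakk>t \<in> {a..b}; t \<notin> P; s \<in> {0..1}; s' \<in> {0..1}\<rbrakk> \<Longrightarrow> \<phi> t s = \<phi> t s'"
  proof -
    assume t: "t \<in> {a..b}" "t \<notin> P" and s: "s \<in> {0..1}" "s' \<in> {0..1}"
    then have "stationary \<phi> t" using assms by (auto simp: decorated_pairs_def)
    then show "\<phi> t s = \<phi> t s'" using s by (auto simp: stationary_def)
  qed
qed (use assms in \<open>auto simp: decorated_pairs_def cadlag_space_def dest: PiE_mem\<close>)

lemma decorated_oscillation_finite:
  assumes dec: "(\<phi>, P) \<in> decorated_pairs a b" and "\<epsilon> > 0"
  shows "finite {t\<in>{a..b}. \<exists>s\<in>{0..1}. \<exists>s'\<in>{0..1}. norm (\<phi> t s - \<phi> t s') > \<epsilon>}"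
proof (rule finite_subset)
  show "finite {t\<in>P. (SUP s\<in>{0..1}. norm (\<phi> t s - \<phi> t 0)) > \<epsilon>/2}"
    using decorated_pairsD(6)[OF dec, of "\<epsilon>/2"] \<open>\<epsilon> > 0\<close> by simp
  show "{t\<in>{a..b}. \<exists>s\<in>{0..1}. \<exists>s'\<in>{0..1}. norm (\<phi> t s - \<phi> t s') > \<epsilon>}
    \<subseteq> {t\<in>P. (SUP s\<in>{0..1}. norm (\<phi> t s - \<phi> t 0)) > \<epsilon>/2}"
  proof safe
    fix t s s' assume t: "t \<in> {a..b}" and s: "s \<in> {0..1::real}" "s' \<in> {0..1::real}"
      and gt: "norm (\<phi> t s - \<phi> t s') > \<epsilon>"
    show "t \<in> P"
      using decorated_pairsD(5)[OF dec t _ s] gt \<open>\<epsilon> > 0\<close> by force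
    obtain B where B: "\<And>s. s \<in> {0..1} \<Longrightarrow> norm (\<phi> t s) \<le> B"
      using cadlag_on_bounded[OF decorated_pairsD(1)[OF dec t]] unfolding bounded_iff
      by (metis compact_Icc imageI)
    have bdd: "bdd_above ((\<lambda>s. norm (\<phi> t s - \<phi> t 0)) ` {0..1})"
    proof (rule bdd_aboveI2)
      fix s :: real assume "s \<in> {0..1}"
      then show "norm (\<phi> t s - \<phi> t 0) \<le> B + B"
        by (intro norm_triangle_le_diff add_mono B) auto
    qed
    have "norm (\<phi> t s - \<phi> t 0) \<le> (SUP s\<in>{0..1}. norm (\<phi> t s - \<phi> t 0))"
      "norm (\<phi> t s' - \<phi> t 0) \<le> (SUP s\<in>{0..1}. norm (\<phi> t s - \<phi> t 0))"
      using cSUP_upper[OF s(1) bdd] cSUP_upper[OF s(2) bdd] .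
    then show "(SUP s\<in>{0..1}. norm (\<phi> t s - \<phi> t 0)) > \<epsilon>/2"
      using gt norm_triangle_ineq4[of "\<phi> t s - \<phi> t 0" "\<phi> t s' - \<phi> t 0"] by simp
  qed
qed

text \<open>Inside a rest \<open>h\<close> is a rescaled excursion. At the end \<open>r t\<close> (or the start \<open>l t\<close>) of a rest the
nearby parameters on the other side belong to different times close to \<open>t\<close>, whose excursions become
negligible, so that there \<open>h\<close> behaves like the cadlag function \<open>\<phi> s 1\<close> of the time \<open>s\<close>.\<close>

lemma presents_cadlag:
  fixes \<phi> :: "real \<Rightarrow> real \<Rightarrow> 'a::real_normed_vector"
  assumes dec: "(\<phi>, P) \<in> decorated_pairs a b" and X: "presents a b (\<phi>, P) (d, m, h)"
  shows "cadlag_on {a..d} h"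
proof -
  obtain l r where "a < d" and mono: "mono_on {a..d} m" and surj: "m ` {a..d} = {a..b}"
    and fib: "\<And>t. t \<in> {a..b} \<Longrightarrow> {u\<in>{a..d}. m u = t} = {l t..r t}"
    and le: "\<And>t. t \<in> {a..b} \<Longrightarrow> l t \<le> r t"
    and mark: "\<And>t. t \<in> {a..b} \<Longrightarrow> l t < r t \<longleftrightarrow> t \<in> marks b P"
    and h: "\<And>t u. t \<in> {a..b} \<Longrightarrow> u \<in> {l t..r t} \<Longrightarrow> h u = \<phi> t ((u - l t) / (r t - l t))"
    and m: "\<And>u. u \<in> {a..d} \<Longrightarrow> m u \<in> {a..b}"
    and lr: "\<And>u. u \<in> {a..d} \<Longrightarrow> u \<in> {l (m u)..r (m u)}"
    by (rule presentsE[OF X]) blast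
  have cont: "continuous_on {a..d} m" by (rule mono_on_surj_continuous_on[OF mono surj])
  have frac: "(u - l t) / (r t - l t) \<in> {0..1}" if "u \<in> {l t..r t}" for t u
    using that by (auto simp: divide_le_eq_1)
  have plateau: "cadlag_on {l t..r t} h" if t: "t \<in> {a..b}" for t
  proof -
    have "cadlag_on {l t..r t} (\<lambda>u. \<phi> t ((u - l t) / (r t - l t)))"
    proof (rule cadlag_on_compose_mono[OF decorated_pairsD(1)[OF dec t]])
      show "mono_on {l t..r t} (\<lambda>u. (u - l t) / (r t - l t))"
        using le[OF t] by (intro mono_onI divide_right_mono) auto
      show "continuous_on {l t..r t} (\<lambda>u. (u - l t) / (r t - l t))"
        by (cases "l t = r t") (auto intro!: continuous_intros)
    qed (use frac in blast)
    then show ?thesis using h[OF t] by (subst cadlag_on_cong) auto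
  qed
  \<comment> \<open>Outside a finite set of times the excursions are smaller than any given bound, and times
     that approach \<open>m u\<close> without attaining it leave every finite set. Hence along such times \<open>h\<close>
     has the same limit as the endpoints \<open>\<phi> s 1\<close>.\<close>
  have limit: "(h \<longlongrightarrow> L) (at u within B)"
    if u: "u \<in> {a..d}" and B: "B \<subseteq> {a..d}"
      and filt: "filterlim m (at (m u) within A) (at u within B)"
      and L: "((\<lambda>s. \<phi> s 1) \<longlongrightarrow> L) (at (m u) within A)" for u B A L
  proof -
    have small: "((\<lambda>v. h v - \<phi> (m v) 1) \<longlongrightarrow> 0) (at u within B)"
    proof (rule tendstoI)
      fix e :: real assume "e > 0"
      define F where "F = {t\<in>{a..b}. \<exists>s\<in>{0..1}. \<exists>s'\<in>{0..1}. norm (\<phi> t s - \<phi> t s') > e/2}"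
      have "finite F"
        unfolding F_def using decorated_oscillation_finite[OF dec, of "e/2"] \<open>e > 0\<close> by simp
      then have "\<forall>\<^sub>F s in at (m u) within A. \<forall>f\<in>F. s \<noteq> f"
        by (intro eventually_ball_finite ballI eventually_neq_at_within)
      then have "\<forall>\<^sub>F v in at u within B. \<forall>f\<in>F. m v \<noteq> f"
        using filt by (rule eventually_compose_filterlim)
      moreover have "\<forall>\<^sub>F v in at u within B. v \<in> B" by (simp add: eventually_at_filter)
      ultimately show "\<forall>\<^sub>F v in at u within B. dist (h v - \<phi> (m v) 1) 0 < e"
      proof eventually_elim
        case (elim v)
        then have v: "v \<in> {a..d}" using B by blast
        have "h v = \<phi> (m v) ((v - l (m v)) / (r (m v) - l (m v)))" using h[OF m[OF v] lr[OF v]] .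
        moreover have "m v \<notin> F" using elim by blast
        moreover have "(1::real) \<in> {0..1}" by simp
        ultimately have "norm (h v - \<phi> (m v) 1) \<le> e/2"
          using frac[OF lr[OF v]] m[OF v] unfolding F_def mem_Collect_eq by (metis not_less)
        then show ?case using \<open>e > 0\<close> by simp
      qed
    qed
    have "((\<lambda>v. \<phi> (m v) 1) \<longlongrightarrow> L) (at u within B)"
      using L filt by (rule filterlim_compose)
    from tendsto_add[OF small this] show ?thesis by simp
  qed
  have lim_m: "(m \<longlongrightarrow> m u) (at u within {a..d} \<inter> A)" if "u \<in> {a..d}" for u A
    using cont that by (meson Int_lower1 continuous_on_def tendsto_within_subset)
  show ?thesis unfolding cadlag_on_def
  proof (intro ballI conjI)
    fix u assume u: "u \<in> {a..d}"
    define t where "t = m u"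
    have t: "t \<in> {a..b}" and ulr: "u \<in> {l t..r t}" using m[OF u] lr[OF u] by (auto simp: t_def)
    have sub: "{l t..r t} \<subseteq> {a..d}" using fib[OF t] by blast
    show "(h \<longlongrightarrow> h u) (at u within {a..d} \<inter> {u<..})"
    proof (cases "u < r t")
      case True
      have "(h \<longlongrightarrow> h u) (at u within {l t..r t} \<inter> {u<..})"
        using plateau[OF t] ulr by (auto simp: cadlag_on_def)
      also have "at u within {l t..r t} \<inter> {u<..} = at u within {a..d} \<inter> {u<..}"
        by (rule at_within_nhd[of _ "{..<r t}"]) (use True ulr sub in auto)
      finally show ?thesis .
    next
      case False
      then have ur: "u = r t" using ulr by simp
      have "h u = \<phi> t 1"
      proof (cases "l t = r t")
        case True
        then have "t \<notin> P" using mark[OF t] by (auto simp: marks_def split: if_splits)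
        then have "\<phi> t 0 = \<phi> t 1" by (intro decorated_pairsD(5)[OF dec t]) auto
        then show ?thesis using h[OF t ulr] True by simp
      qed (use h[OF t ulr] ur in auto)
      then have "((\<lambda>s. \<phi> s 1) \<longlongrightarrow> h u) (at t within {a..b} \<inter> {t<..})"
        using decorated_pairsD(2)[OF dec] t by (simp add: cadlag_on_def)
      moreover have "filterlim m (at (m u) within {a..b} \<inter> {t<..}) (at u within {a..d} \<inter> {u<..})"
      proof -
        have "\<forall>\<^sub>F v in at u within {a..d} \<inter> {u<..}. v \<in> {a..d} \<inter> {u<..}"
          by (simp add: eventually_at_filter)
        then have "\<forall>\<^sub>F v in at u within {a..d} \<inter> {u<..}. m v \<in> {a..b} \<inter> {t<..} \<and> m v \<noteq> m u"
        proof eventually_elim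
          case (elim v)
          then have v: "v \<in> {a..d}" "u < v" by auto
          then have "v \<notin> {l t..r t}" using ur by simp
          then have "m v \<noteq> t" using fib[OF t] v by blast
          moreover have "m u \<le> m v" using u v by (intro mono_onD[OF mono]) auto
          ultimately show ?case using m[OF v(1)] by (simp add: t_def)
        qed
        then show ?thesis using lim_m[OF u] by (simp add: filterlim_at)
      qed
      ultimately show ?thesis by (intro limit[OF u]) (auto simp: t_def)
    qed
    show "\<exists>L. (h \<longlongrightarrow> L) (at u within {a..d} \<inter> {..<u})"
    proof (cases "l t < u")
      case True
      obtain L where "(h \<longlongrightarrow> L) (at u within {l t..r t} \<inter> {..<u})"
        using plateau[OF t] ulr unfolding cadlag_on_def by blast
      also have "at u within {l t..r t} \<inter> {..<u} = at u within {a..d} \<inter> {..<u}"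
        by (rule at_within_nhd[of _ "{l t<..}"]) (use True ulr sub in auto)
      finally show ?thesis by blast
    next
      case False
      then have ul: "u = l t" using ulr by simp
      obtain L where "((\<lambda>s. \<phi> s 1) \<longlongrightarrow> L) (at t within {a..b} \<inter> {..<t})"
        using decorated_pairsD(2)[OF dec] t unfolding cadlag_on_def by blast
      moreover have "filterlim m (at (m u) within {a..b} \<inter> {..<t}) (at u within {a..d} \<inter> {..<u})"
      proof -
        have "\<forall>\<^sub>F v in at u within {a..d} \<inter> {..<u}. v \<in> {a..d} \<inter> {..<u}"
          by (simp add: eventually_at_filter)
        then have "\<forall>\<^sub>F v in at u within {a..d} \<inter> {..<u}. m v \<in> {a..b} \<inter> {..<t} \<and> m v \<noteq> m u"
        proof eventually_elim
          case (elim v)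
          then have v: "v \<in> {a..d}" "v < u" by auto
          then have "v \<notin> {l t..r t}" using ul by simp
          then have "m v \<noteq> t" using fib[OF t] v by blast
          moreover have "m v \<le> m u" using u v by (intro mono_onD[OF mono]) auto
          ultimately show ?case using m[OF v(1)] by (simp add: t_def)
        qed
        then show ?thesis using lim_m[OF u] by (simp add: filterlim_at)
      qed
      ultimately have "(h \<longlongrightarrow> L) (at u within {a..d} \<inter> {..<u})"
        by (intro limit[OF u]) (auto simp: t_def)
      then show ?thesis ..
    qed
  qed
qed

section \<open>Every timed path with a plateau presents a decorated path\<close>

text \<open>The fibres of a continuous monotone clock are compact and convex.\<close>

lemma mono_fibre_interval:
  fixes m :: "real \<Rightarrow> real"
  assumes mono: "mono_on {a..d} m" and surj: "m ` {a..d} = {a..b}"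
  shows "\<exists>l r. {u\<in>{a..d}. m u = t} = {l..r}"
proof -
  have "closed {u\<in>{a..d}. m u = t}"
    using mono_on_surj_continuous_on[OF mono surj] by (rule continuous_closed_preimage_constant) auto
  then have "compact ({a..d} \<inter> {u\<in>{a..d}. m u = t})"
    by (intro compact_Int_closed) auto
  moreover have "{a..d} \<inter> {u\<in>{a..d}. m u = t} = {u\<in>{a..d}. m u = t}" by blast
  moreover have "is_interval {u\<in>{a..d}. m u = t}"
    unfolding is_interval_1
  proof (intro ballI allI impI)
    fix u v x assume "u \<in> {u\<in>{a..d}. m u = t}" "v \<in> {u\<in>{a..d}. m u = t}" "u \<le> x \<and> x \<le> v"
    then show "x \<in> {u\<in>{a..d}. m u = t}"
      using mono_onD[OF mono, of u x] mono_onD[OF mono, of x v] by auto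
  qed
  ultimately show ?thesis
    using connected_compact_interval_1 is_interval_connected by metis
qed

text \<open>As \<open>s\<close> decreases to \<open>t\<close>, the end \<open>r s\<close> of the fibre decreases strictly to \<open>r t\<close>; as \<open>s\<close> increases
to \<open>t\<close>, it increases strictly to the start \<open>l t\<close> of the fibre. So the one-sided limits of \<open>h\<close> at
\<open>r t\<close> and \<open>l t\<close> are the ones needed.\<close>

lemma cadlag_on_fibre_ends:
  fixes h :: "real \<Rightarrow> 'a::real_normed_vector"
  assumes mono: "mono_on {a..d} m"
    and fib: "\<And>t. t \<in> {a..b} \<Longrightarrow> {u\<in>{a..d}. m u = t} = {l t..r t}"
    and le: "\<And>t. t \<in> {a..b} \<Longrightarrow> l t \<le> r t"
    and m: "\<And>u. u \<in> {a..d} \<Longrightarrow> m u \<in> {a..b}"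
    and h: "cadlag_on {a..d} h"
  shows "cadlag_on {a..b} (\<lambda>t. h (r t))"
  unfolding cadlag_on_def
proof (intro ballI conjI)
  fix t assume t: "t \<in> {a..b}"
  have ends: "l s \<in> {a..d}" "m (l s) = s" "r s \<in> {a..d}" "m (r s) = s" if "s \<in> {a..b}" for s
  proof -
    have "l s \<in> {l s..r s}" "r s \<in> {l s..r s}" using le[OF that] by auto
    then show "l s \<in> {a..d}" "m (l s) = s" "r s \<in> {a..d}" "m (r s) = s"
      using fib[OF that] by blast+
  qed
  have less: "r s < l s'" if "s \<in> {a..b}" "s' \<in> {a..b}" "s < s'" for s s'
    using ends[OF that(1)] ends[OF that(2)] mono_onD[OF mono, of "l s'" "r s"] that(3) by force
  have "filterlim r (at (r t) within {a..d} \<inter> {r t<..}) (at t within {a..b} \<inter> {t<..})"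
    unfolding filterlim_at
  proof
    have later: "\<forall>\<^sub>F s in at t within {a..b} \<inter> {t<..}. s \<in> {a..b} \<inter> {t<..}"
      by (simp add: eventually_at_filter)
    have above: "r s \<in> {a..d} \<inter> {r t<..}" if "s \<in> {a..b} \<inter> {t<..}" for s
      using less[of t s] le[of s] ends(3)[of s] that t by auto
    show "\<forall>\<^sub>F s in at t within {a..b} \<inter> {t<..}. r s \<in> {a..d} \<inter> {r t<..} \<and> r s \<noteq> r t"
      using later by eventually_elim (use above in force)
    show "(r \<longlongrightarrow> r t) (at t within {a..b} \<inter> {t<..})"
    proof (rule order_tendstoI)
      fix y assume "y < r t"
      show "\<forall>\<^sub>F s in at t within {a..b} \<inter> {t<..}. y < r s"
        using later by eventually_elim (use above \<open>y < r t\<close> in force)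
    next
      fix y assume y: "r t < y"
      show "\<forall>\<^sub>F s in at t within {a..b} \<inter> {t<..}. r s < y"
      proof (cases "y \<le> d")
        case False
        show ?thesis using later by eventually_elim (use above False in force)
      next
        case True
        then have yI: "y \<in> {a..d}" using y ends(3)[OF t] by auto
        have "m (r t) \<le> m y" using y yI ends(3)[OF t] by (intro mono_onD[OF mono]) auto
        moreover have "y \<notin> {l t..r t}" using y le[OF t] by simp
        then have "m y \<noteq> t" using fib[OF t] yI by blast
        ultimately have "t < m y" using ends(4)[OF t] by simp
        then have "\<forall>\<^sub>F s in at t within {a..b} \<inter> {t<..}. s < m y"
          by (rule order_tendstoD(2)[OF tendsto_ident_at])
        with later show ?thesis
        proof eventually_elim
          case (elim s)
          then have "s \<in> {a..b}" by blast
          then show ?case using elim ends[of s] mono_onD[OF mono yI, of "r s"] by force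
        qed
      qed
    qed
  qed
  moreover have "(h \<longlongrightarrow> h (r t)) (at (r t) within {a..d} \<inter> {r t<..})"
    using h ends(3)[OF t] by (simp add: cadlag_on_def)
  ultimately show "((\<lambda>s. h (r s)) \<longlongrightarrow> h (r t)) (at t within {a..b} \<inter> {t<..})"
    by (rule filterlim_compose[rotated])
  have left: "filterlim r (at (l t) within {a..d} \<inter> {..<l t}) (at t within {a..b} \<inter> {..<t})"
    unfolding filterlim_at
  proof
    have earlier: "\<forall>\<^sub>F s in at t within {a..b} \<inter> {..<t}. s \<in> {a..b} \<inter> {..<t}"
      by (simp add: eventually_at_filter)
    have below: "r s \<in> {a..d} \<inter> {..<l t}" if "s \<in> {a..b} \<inter> {..<t}" for s
      using less[of s t] ends(3)[of s] that t by auto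
    show "\<forall>\<^sub>F s in at t within {a..b} \<inter> {..<t}. r s \<in> {a..d} \<inter> {..<l t} \<and> r s \<noteq> l t"
      using earlier by eventually_elim (use below in force)
    show "(r \<longlongrightarrow> l t) (at t within {a..b} \<inter> {..<t})"
    proof (rule order_tendstoI)
      fix y assume "l t < y"
      show "\<forall>\<^sub>F s in at t within {a..b} \<inter> {..<t}. r s < y"
        using earlier by eventually_elim (use below \<open>l t < y\<close> in force)
    next
      fix y assume y: "y < l t"
      show "\<forall>\<^sub>F s in at t within {a..b} \<inter> {..<t}. y < r s"
      proof (cases "a \<le> y")
        case False
        show ?thesis using earlier by eventually_elim (use below False in force)
      next
        case True
        then have yI: "y \<in> {a..d}" using y ends(1)[OF t] by auto
        have "m y \<le> m (l t)" using y yI ends(1)[OF t] by (intro mono_onD[OF mono]) auto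
        moreover have "y \<notin> {l t..r t}" using y le[OF t] by simp
        then have "m y \<noteq> t" using fib[OF t] yI by blast
        ultimately have "m y < t" using ends(2)[OF t] by simp
        then have "\<forall>\<^sub>F s in at t within {a..b} \<inter> {..<t}. m y < s"
          by (rule order_tendstoD(1)[OF tendsto_ident_at])
        with earlier show ?thesis
        proof eventually_elim
          case (elim s)
          then have "s \<in> {a..b}" by blast
          then show ?case using elim ends[of s] mono_onD[OF mono _ yI, of "r s"] by force
        qed
      qed
    qed
  qed
  obtain L where "(h \<longlongrightarrow> L) (at (l t) within {a..d} \<inter> {..<l t})"
    using h ends(1)[OF t] unfolding cadlag_on_def by blast
  from filterlim_compose[OF this left]
  show "\<exists>L. ((\<lambda>s. h (r s)) \<longlongrightarrow> L) (at t within {a..b} \<inter> {..<t})" ..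
qed

text \<open>Cut \<open>h\<close> at the fibres of the clock and call the times with a nondegenerate fibre marked. These
are countably many, since such a fibre contains a rational number, and only finitely many of them
carry a large oscillation by \<open>cadlag_on_oscillation_cover\<close>. At least one plateau is required: without any, the set of marked
times would be empty, which stands for a rest at \<open>b\<close>.\<close>

lemma presents_exists:
  fixes h :: "real \<Rightarrow> 'a::real_normed_vector"
  assumes "a < d" and mono: "mono_on {a..d} m" and surj: "m ` {a..d} = {a..b}"
    and h: "cadlag_on {a..d} h"
    and plateau: "u0 \<in> {a..d}" "u1 \<in> {a..d}" "u0 < u1" "m u0 = m u1"
  obtains x where "x \<in> decorated_pairs a b" "presents a b x (d, m, h)"
proof -
  obtain l r where fib: "\<And>t. {u\<in>{a..d}. m u = t} = {l t..r t}"
    using mono_fibre_interval[OF mono surj] by metis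
  have m: "m u \<in> {a..b}" if "u \<in> {a..d}" for u using surj that by blast
  have le: "l t \<le> r t" if t: "t \<in> {a..b}" for t
  proof -
    obtain u where "u \<in> {a..d}" "m u = t" using t surj by (metis imageE)
    then have "u \<in> {l t..r t}" using fib by blast
    then show ?thesis by simp
  qed
  have sub: "{l t..r t} \<subseteq> {a..d}" for t using fib[of t] by blast
  define P where "P = {t\<in>{a..b}. l t < r t}"
  define \<phi> where "\<phi> = (\<lambda>t\<in>{a..b}. \<lambda>s\<in>{0..1}. h (l t + s * (r t - l t)))"
  have \<phi>: "\<phi> t s = h (l t + s * (r t - l t))" if "t \<in> {a..b}" "s \<in> {0..1}" for t s
    using that by (simp add: \<phi>_def)
  have inside: "l t + s * (r t - l t) \<in> {l t..r t}" if "t \<in> {a..b}" "s \<in> {0..1}" for t s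
    using that le[OF that(1)] mult_right_mono[of s 1 "r t - l t"] by auto
  have "{u0, u1} \<subseteq> {l (m u0)..r (m u0)}"
    unfolding fib[of "m u0", symmetric] using plateau by auto
  then have "m u0 \<in> P" using m plateau by (auto simp: P_def)
  then have marks: "marks b P = P" by (auto simp: marks_def)
  have "\<phi> t \<in> cadlag_space {0..1}" if t: "t \<in> {a..b}" for t
  proof -
    have "cadlag_on {0..1} (\<lambda>s. h (l t + s * (r t - l t)))"
    proof (rule cadlag_on_compose_mono[OF h])
      show "mono_on {0..1} (\<lambda>s. l t + s * (r t - l t))"
        using le[OF t] by (intro mono_onI add_left_mono mult_right_mono) auto
      show "(\<lambda>s. l t + s * (r t - l t)) ` {0..1} \<subseteq> {a..d}" using inside[OF t] sub by blast
    qed (intro continuous_intros)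
    then have "cadlag_on {0..1} (\<phi> t)" using \<phi>[OF t] by (subst cadlag_on_cong) auto
    then show ?thesis using t by (simp add: cadlag_space_def \<phi>_def)
  qed
  then have 1: "\<phi> \<in> {a..b} \<rightarrow>\<^sub>E cadlag_space {0..1}" by (auto simp: \<phi>_def)
  have "cadlag_on {a..b} (\<lambda>t. h (r t))"
    by (rule cadlag_on_fibre_ends[OF mono fib le m h])
  then have 2: "cadlag_on {a..b} (\<lambda>t. \<phi> t 1)" using \<phi>[of _ 1] by (subst cadlag_on_cong) auto
  have "P \<subseteq> m ` (\<rat> \<inter> {a..d})"
  proof
    fix t assume "t \<in> P"
    then obtain q where "q \<in> \<rat>" "l t < q" "q < r t" using Rats_dense_in_real by (auto simp: P_def)
    then have "q \<in> \<rat>" "q \<in> {u\<in>{a..d}. m u = t}" unfolding fib[of t] by auto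
    then show "t \<in> m ` (\<rat> \<inter> {a..d})" by blast
  qed
  then have 3: "countable P"
    by (meson countable_Int1 countable_image countable_rat countable_subset)
  have 4: "t \<in> P" if t: "t \<in> {a..b}" "\<not> stationary \<phi> t" for t
  proof (rule ccontr)
    assume "t \<notin> P"
    then have "l t = r t" using le[OF t(1)] t by (auto simp: P_def)
    then have "stationary \<phi> t" using \<phi>[OF t(1)] by (auto simp: stationary_def)
    with t show False by simp
  qed
  have 5: "finite {t\<in>P. (SUP s\<in>{0..1}. norm (\<phi> t s - \<phi> t 0)) > \<epsilon>}" if "\<epsilon> > 0" for \<epsilon>
  proof -
    obtain E where "finite E"
      and E: "\<And>x y. \<lbrakk>{x..y} \<subseteq> {a..d}; x \<le> y; {x..y} \<inter> E = {}\<rbrakk> \<Longrightarrow> norm (h x - h y) < \<epsilon>"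
      by (rule cadlag_on_oscillation_cover[OF h compact_Icc \<open>\<epsilon> > 0\<close>]) blast
    have "{t\<in>P. (SUP s\<in>{0..1}. norm (\<phi> t s - \<phi> t 0)) > \<epsilon>} \<subseteq> m ` E"
    proof (rule ccontr)
      assume "\<not> ?thesis"
      then obtain t where "t \<in> P" and gt: "(SUP s\<in>{0..1}. norm (\<phi> t s - \<phi> t 0)) > \<epsilon>" and "t \<notin> m ` E"
        by blast
      then have t: "t \<in> {a..b}" and dis: "{l t..r t} \<inter> E = {}"
        using fib[of t] by (auto simp: P_def)
      have "(SUP s\<in>{0..1}. norm (\<phi> t s - \<phi> t 0)) \<le> \<epsilon>"
      proof (rule cSUP_least)
        fix s :: real assume s: "s \<in> {0..1}"
        define y where "y = l t + s * (r t - l t)"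
        have "y \<in> {l t..r t}" unfolding y_def by (rule inside[OF t s])
        then have "{l t..y} \<subseteq> {l t..r t}" "l t \<le> y" by auto
        then have "norm (h (l t) - h y) < \<epsilon>" using dis sub[of t] by (intro E) blast+
        then show "norm (\<phi> t s - \<phi> t 0) \<le> \<epsilon>"
          using \<phi>[OF t s] \<phi>[OF t, of 0] by (simp add: y_def norm_minus_commute)
      qed simp
      with gt show False by simp
    qed
    then show ?thesis using \<open>finite E\<close> finite_subset by blast
  qed
  have dec: "(\<phi>, P) \<in> decorated_pairs a b"
    unfolding decorated_pairs_def using 1 2 3 4 5 by (auto simp: P_def)
  have "presents a b (\<phi>, P) (d, m, h)"
  proof (rule presentsI[where l = l and r = r])
    fix t u assume t: "t \<in> {a..b}" and u: "u \<in> {l t..r t}"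
    have "(u - l t) / (r t - l t) \<in> {0..1}" using u by (auto simp: divide_le_eq_1)
    from \<phi>[OF t this] show "h u = \<phi> t ((u - l t) / (r t - l t))" using u by (cases "l t = r t") auto
  qed (use assms fib marks in \<open>auto simp: P_def\<close>)
  with dec show ?thesis by (rule that)
qed

lemma prolong_presents_exists:
  fixes h :: "real \<Rightarrow> 'a::real_normed_vector"
  assumes "a < d" and mono: "mono_on {a..d} m" and surj: "m ` {a..d} = {a..b}"
    and h: "cadlag_on {a..d} h"
  obtains x where "x \<in> decorated_pairs a b" "presents a b x (prolong a (d, m, h))"
proof -
  let ?\<theta> = "\<lambda>u. max a (u - 1)"
  have mono\<theta>: "mono_on {a..d+1} ?\<theta>" by (intro mono_onI) auto
  have im: "?\<theta> ` {a..d+1} = {a..d}"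
  proof (intro equalityI subsetI)
    fix v assume "v \<in> {a..d}"
    then show "v \<in> ?\<theta> ` {a..d+1}" by (intro image_eqI[of _ _ "v + 1"]) auto
  qed (use \<open>a < d\<close> in auto)
  have "a < d + 1" using \<open>a < d\<close> by simp
  moreover have "mono_on {a..d+1} (\<lambda>u. m (?\<theta> u))"
    using \<open>a < d\<close> by (intro mono_onI mono_onD[OF mono]) auto
  moreover have "(\<lambda>u. m (?\<theta> u)) ` {a..d+1} = {a..b}"
    using image_image[of m ?\<theta> "{a..d+1}"] im surj by simp
  moreover have "cadlag_on {a..d+1} (\<lambda>u. h (?\<theta> u))"
    using im by (intro cadlag_on_compose_mono[OF h mono\<theta>]) (auto intro!: continuous_intros)
  moreover have "a \<in> {a..d+1}" "a + 1 \<in> {a..d+1}" "a < a + 1" "m (?\<theta> a) = m (?\<theta> (a + 1))"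
    using \<open>a < d\<close> by auto
  ultimately obtain x where "x \<in> decorated_pairs a b"
    "presents a b x (d + 1, \<lambda>u. m (?\<theta> u), \<lambda>u. h (?\<theta> u))"
    by (rule presents_exists)
  then show ?thesis by (intro that) (simp_all add: prolong_def)
qed

section \<open>The extension of a decorated path\<close>

lemma has_sum_real_diff:
  fixes f g :: "'i \<Rightarrow> real"
  assumes "(f has_sum x) N" and "(g has_sum y) N"
  shows "((\<lambda>j. f j - g j) has_sum (x - y)) N"
  using has_sum_add[OF assms(1) has_sum_uminusI[OF assms(2)]] by simp

text \<open>Finitely many summands carry all but a small part of the total weight \<open>infsum w N\<close>.\<close>

lemma tendsto_infsum_of_bool:
  fixes w :: "'i \<Rightarrow> real"
  assumes w: "w summable_on N" and nonneg: "\<And>j. j \<in> N \<Longrightarrow> 0 \<le> w j"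
    and ev: "\<And>j. j \<in> N \<Longrightarrow> \<forall>\<^sub>F x in F. A j x \<longleftrightarrow> B j"
  shows "((\<lambda>x. \<Sum>\<^sub>\<infinity>j\<in>N. w j * of_bool (A j x)) \<longlongrightarrow> (\<Sum>\<^sub>\<infinity>j\<in>N. w j * of_bool (B j))) F"
proof (rule tendstoI)
  fix e :: real assume "e > 0"
  have sub: "(\<lambda>j. w j * of_bool (Q j)) summable_on N" for Q
    by (rule summable_on_comparison_test[OF w]) (auto simp: nonneg)
  obtain G where G: "finite G" "G \<subseteq> N" "dist (sum w G) (infsum w N) \<le> e / 2"
    using infsum_finite_approximation[OF w, of "e / 2"] \<open>e > 0\<close> by auto
  have tail: "((\<lambda>j. w j - w j * of_bool (j \<in> G)) has_sum (infsum w N - sum w G)) N"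
  proof (rule has_sum_real_diff[OF has_sum_infsum[OF w]])
    have "(w has_sum sum w G) G" using G(1) by (rule has_sum_finite)
    then show "((\<lambda>j. w j * of_bool (j \<in> G)) has_sum sum w G) N"
      by (rule has_sum_cong_neutral[THEN iffD1, rotated -1]) (use G(2) in auto)
  qed
  have "\<forall>\<^sub>F x in F. \<forall>j\<in>G. A j x \<longleftrightarrow> B j"
    using G ev by (intro eventually_ball_finite) auto
  then show "\<forall>\<^sub>F x in F. dist (\<Sum>\<^sub>\<infinity>j\<in>N. w j * of_bool (A j x)) (\<Sum>\<^sub>\<infinity>j\<in>N. w j * of_bool (B j)) < e"
  proof eventually_elim
    case (elim x)
    have "norm ((\<Sum>\<^sub>\<infinity>j\<in>N. w j * of_bool (A j x)) - (\<Sum>\<^sub>\<infinity>j\<in>N. w j * of_bool (B j)))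
      \<le> infsum w N - sum w G"
    proof (rule norm_infsum_le[OF has_sum_real_diff[OF has_sum_infsum[OF sub] has_sum_infsum[OF sub]] tail])
      fix j assume "j \<in> N"
      then show "norm (w j * of_bool (A j x) - w j * of_bool (B j)) \<le> w j - w j * of_bool (j \<in> G)"
        using elim nonneg[of j] by auto
    qed
    then show ?case using G(3) \<open>e > 0\<close> by (simp add: dist_real_def)
  qed
qed

text \<open>Write \<open>r\<close> for \<open>tau\<close> and \<open>l\<close> for its left limit, which adds only the widths of
earlier marked times. The
intervals \<open>{l t..r t}\<close> are disjoint, ordered like the times, cover \<open>{a..b+\<delta>}\<close>, and are nondegenerate
exactly at the marked times; the clock sends each parameter to the time of its interval. It lags
behind the identity by at most the total width \<open>\<delta>\<close>.\<close>

lemma delta_extension_presents_nonempty: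
  fixes \<phi> :: "real \<Rightarrow> real \<Rightarrow> 'a::real_normed_vector"
  assumes "a < b" and dec: "(\<phi>, P) \<in> decorated_pairs a b" and "P \<noteq> {}"
    and e: "enumerates e P" and "\<delta> > 0"
  obtains m where "presents a b (\<phi>, P) (b + \<delta>, m, delta_extension a b \<phi> P e \<delta>)"
    and "\<And>u. u \<in> {a..b+\<delta>} \<Longrightarrow> \<bar>m u - u\<bar> \<le> \<delta>"
proof -
  define N where "N = index_set P"
  define w where "w = width P \<delta>"
  define S where "S Q = (\<Sum>\<^sub>\<infinity>j\<in>N. w j * of_bool (Q (e j)))" for Q
  have PI: "P \<subseteq> {a..b}" by (rule decorated_pairsD(3)[OF dec])
  have bij: "bij_betw e N P" using e by (simp add: enumerates_def N_def)
  have eP: "e j \<in> P" if "j \<in> N" for j using bij_betwE[OF bij] that by blast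
  then have eI: "e j \<in> {a..b}" if "j \<in> N" for j using PI that by blast
  obtain i0 where i0: "i0 \<in> N" using bij \<open>P \<noteq> {}\<close> by (auto simp: bij_betw_def)

  have geo: "(\<lambda>i. (1/2::real) ^ i) summable_on N"
  proof (rule summable_on_subset)
    show "(\<lambda>i. (1/2::real) ^ i) summable_on UNIV"
      by (subst summable_on_UNIV_nonneg_real_iff) (auto intro: summable_geometric)
  qed simp
  define W where "W = (\<Sum>\<^sub>\<infinity>i\<in>N. (1/2::real) ^ i)"
  have "(1/2) ^ i0 \<le> W"
    using finite_sum_le_infsum[OF geo, of "{i0}"] i0 by (simp add: W_def)
  then have "W > 0" by (smt (verit) zero_less_power half_gt_zero_iff)
  have w_eq: "w j = \<delta> / W * (1/2) ^ j" for j by (simp add: w_def width_def W_def N_def)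
  have w_pos: "w j > 0" for j using \<open>W > 0\<close> \<open>\<delta> > 0\<close> by (simp add: w_eq)
  have w_sum: "w summable_on N" unfolding w_eq by (rule summable_on_cmult_right[OF geo])
  have w_total: "infsum w N = \<delta>"
    unfolding w_eq infsum_cmult_right' W_def[symmetric] using \<open>W > 0\<close> by simp
  have Q_sum: "(\<lambda>j. w j * of_bool (Q j)) summable_on N" for Q
    by (rule summable_on_comparison_test[OF w_sum]) (auto simp: less_imp_le[OF w_pos])

  have S_mono: "S Q \<le> S Q'" if "\<And>t. t \<in> {a..b} \<Longrightarrow> Q t \<Longrightarrow> Q' t" for Q Q'
    unfolding S_def using that eI w_pos less_imp_le by (intro infsum_mono Q_sum) force
  have S_nonneg: "0 \<le> S Q" for Q
    unfolding S_def by (rule infsum_nonneg) (simp add: less_imp_le[OF w_pos])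
  have S_True: "S (\<lambda>_. True) = \<delta>" by (simp add: S_def w_total)
  have S_jump: "S (\<lambda>t. t \<le> e j) = S (\<lambda>t. t < e j) + w j" if j: "j \<in> N" for j
  proof -
    have "((\<lambda>i. w i * of_bool (e i < e j) + w i * of_bool (i = j)) has_sum
        (S (\<lambda>t. t < e j) + w j)) N"
    proof (rule has_sum_add)
      show "((\<lambda>i. w i * of_bool (e i < e j)) has_sum S (\<lambda>t. t < e j)) N"
        unfolding S_def by (rule has_sum_infsum[OF Q_sum])
      have "(w has_sum w j) {j}" using has_sum_finite[of "{j}" w] by simp
      then show "((\<lambda>i. w i * of_bool (i = j)) has_sum w j) N"
        by (rule has_sum_cong_neutral[THEN iffD1, rotated -1]) (use j in auto)
    qed
    moreover have "w i * of_bool (e i < e j) + w i * of_bool (i = j) = w i * of_bool (e i \<le> e j)"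
      if "i \<in> N" for i
      using bij_betw_imp_inj_on[OF bij] j that by (auto simp: inj_on_def of_bool_def)
    ultimately have "((\<lambda>i. w i * of_bool (e i \<le> e j)) has_sum (S (\<lambda>t. t < e j) + w j)) N"
      using has_sum_cong by force
    then show ?thesis unfolding S_def by (rule infsumI)
  qed

  define r where "r t = tau P e \<delta> t" for t
  define l where "l t = t + S (\<lambda>s. s < t)" for t
  have r_eq: "r t = t + S (\<lambda>s. s \<le> t)" for t
    by (simp add: r_def tau_def S_def w_def N_def)
  have r_right: "(r \<longlongrightarrow> r t) (at_right t)" for t
  proof -
    have "((\<lambda>x. \<Sum>\<^sub>\<infinity>j\<in>N. w j * of_bool (e j \<le> x)) \<longlongrightarrow> (\<Sum>\<^sub>\<infinity>j\<in>N. w j * of_bool (e j \<le> t))) (at_right t)"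
    proof (rule tendsto_infsum_of_bool[OF w_sum less_imp_le[OF w_pos]])
      fix j
      show "\<forall>\<^sub>F x in at_right t. (e j \<le> x) = (e j \<le> t)"
      proof (cases "e j \<le> t")
        case True
        then show ?thesis by (auto simp: eventually_at_filter)
      next
        case False
        then have "\<forall>\<^sub>F x in at_right t. x < e j"
          by (intro order_tendstoD(2)[OF tendsto_ident_at]) simp
        then show ?thesis by eventually_elim (use False in auto)
      qed
    qed
    then show ?thesis unfolding r_eq S_def by (intro tendsto_add tendsto_ident_at)
  qed
  have r_left: "(r \<longlongrightarrow> l t) (at_left t)" for t
  proof -
    have "((\<lambda>x. \<Sum>\<^sub>\<infinity>j\<in>N. w j * of_bool (e j \<le> x)) \<longlongrightarrow> (\<Sum>\<^sub>\<infinity>j\<in>N. w j * of_bool (e j < t))) (at_left t)"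
    proof (rule tendsto_infsum_of_bool[OF w_sum less_imp_le[OF w_pos]])
      fix j
      show "\<forall>\<^sub>F x in at_left t. (e j \<le> x) = (e j < t)"
      proof (cases "e j < t")
        case False
        then show ?thesis by (auto simp: eventually_at_filter)
      next
        case True
        then have "\<forall>\<^sub>F x in at_left t. e j < x"
          by (intro order_tendstoD(1)[OF tendsto_ident_at]) simp
        then show ?thesis by eventually_elim (use True in auto)
      qed
    qed
    then show ?thesis unfolding r_eq l_def S_def by (intro tendsto_add tendsto_ident_at)
  qed
  have l_a: "l a = a"
  proof -
    have "S (\<lambda>s. s < a) = S (\<lambda>_. False)" unfolding S_def using eI by (intro infsum_cong) force
    then show ?thesis by (simp add: l_def S_def)
  qed
  have r_b: "r b = b + \<delta>"
  proof -
    have "S (\<lambda>s. s \<le> b) = S (\<lambda>_. True)" unfolding S_def using eI by (intro infsum_cong) force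
    then show ?thesis by (simp add: r_eq S_True)
  qed
  have tau_left: "tau_left a P e \<delta> t = l t" for t
    using tendsto_Lim[OF trivial_limit_at_left_real r_left[of t]] l_a
    by (auto simp: tau_left_def r_def[abs_def])
  have less: "r s < l t" if "s < t" for s t
    using S_mono[of "\<lambda>x. x \<le> s" "\<lambda>x. x < t"] that by (auto simp: r_eq l_def)
  have le: "l t \<le> r t" for t
    using S_mono[of "\<lambda>x. x < t" "\<lambda>x. x \<le> t"] by (auto simp: r_eq l_def)
  have near: "t \<le> l t" "r t \<le> t + \<delta>" for t
    using S_nonneg S_mono[of "\<lambda>x. x \<le> t" "\<lambda>_. True"] S_True by (auto simp: r_eq l_def)
  have r_mono: "r s \<le> r t" if "s \<le> t" for s t
    using that less[of s t] le[of t] by (cases "s = t") auto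
  have jump: "r (e j) = l (e j) + w j" if "j \<in> N" for j
    using S_jump[OF that] by (simp add: r_eq l_def)
  have mark: "l t < r t \<longleftrightarrow> t \<in> P" for t
  proof
    assume "t \<in> P"
    then obtain j where "j \<in> N" "t = e j" using bij by (auto simp: bij_betw_def)
    then show "l t < r t" using jump w_pos[of j] by simp
  next
    assume lt: "l t < r t"
    show "t \<in> P"
    proof (rule ccontr)
      assume "t \<notin> P"
      then have "e j \<le> t \<longleftrightarrow> e j < t" if "j \<in> N" for j
        using eP[OF that] by (cases "e j = t") auto
      then have "S (\<lambda>x. x \<le> t) = S (\<lambda>x. x < t)" unfolding S_def by (intro infsum_cong) auto
      with lt show False by (simp add: r_eq l_def)
    qed
  qed

  \<comment> \<open>The interval containing \<open>u\<close> belongs to the first time \<open>t\<close> with \<open>u \<le> r t\<close>: the one-sided limits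
     of \<open>r\<close> at \<open>t\<close> give \<open>u \<le> r t\<close> and \<open>l t \<le> u\<close>.\<close>
  have "\<exists>t\<in>{a..b}. u \<in> {l t..r t}" if u: "u \<in> {a..b+\<delta>}" for u
  proof -
    define T where "T = {t\<in>{a..b}. u \<le> r t}"
    define t where "t = Inf T"
    have "b \<in> T" using u r_b \<open>a < b\<close> by (simp add: T_def)
    have bdd: "bdd_below T" by (rule bdd_belowI[of _ a]) (simp add: T_def)
    have "a \<le> t" unfolding t_def using \<open>b \<in> T\<close> by (intro cInf_greatest) (auto simp: T_def)
    moreover have "t \<le> b" unfolding t_def by (rule cInf_lower[OF \<open>b \<in> T\<close> bdd])
    moreover have "u \<le> r t"
    proof (rule tendsto_lowerbound[OF r_right])
      have "u \<le> r s" if ts: "t < s" for s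
      proof -
        obtain s' where "s' \<in> T" "s' < s"
          using cInf_lessD[of T s] ts \<open>b \<in> T\<close> unfolding t_def by blast
        then show ?thesis using r_mono[of s' s] by (simp add: T_def)
      qed
      then show "\<forall>\<^sub>F s in at_right t. u \<le> r s" by (simp add: eventually_at_filter)
    qed simp
    moreover have "l t \<le> u"
    proof (cases "t = a")
      case False
      show ?thesis
      proof (rule tendsto_upperbound[OF r_left])
        have "r s \<le> u" if "a < s" "s < t" for s
        proof -
          have "s \<notin> T" using cInf_lower[OF _ bdd, of s] that by (auto simp: t_def)
          then show ?thesis using that \<open>t \<le> b\<close> by (simp add: T_def)
        qed
        moreover have "\<forall>\<^sub>F s in at_left t. a < s"
          using False \<open>a \<le> t\<close> by (intro order_tendstoD(1)[OF tendsto_ident_at]) simp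
        moreover have "\<forall>\<^sub>F s in at_left t. s < t" by (simp add: eventually_at_filter)
        ultimately show "\<forall>\<^sub>F s in at_left t. r s \<le> u"
          by (auto elim: eventually_elim2)
      qed simp
    qed (use l_a u in simp)
    ultimately show ?thesis by auto
  qed
  then obtain m where m: "\<And>u. u \<in> {a..b+\<delta>} \<Longrightarrow> m u \<in> {a..b} \<and> u \<in> {l (m u)..r (m u)}" by metis
  have unique: "s = t" if "u \<in> {l s..r s}" "u \<in> {l t..r t}" for s t u
    using that less[of s t] less[of t s] by (cases s t rule: linorder_cases) auto
  have fib: "{u\<in>{a..b+\<delta>}. m u = t} = {l t..r t}" if t: "t \<in> {a..b}" for t
  proof (intro equalityI subsetI)
    fix u assume u: "u \<in> {l t..r t}"
    then have "u \<in> {a..b+\<delta>}" using near[of t] t by auto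
    then show "u \<in> {u\<in>{a..b+\<delta>}. m u = t}" using unique[OF _ u] m by blast
  qed (use m in blast)
  let ?h = "delta_extension a b \<phi> P e \<delta>"
  have "presents a b (\<phi>, P) (b + \<delta>, m, ?h)"
  proof (rule presentsI[where l = l and r = r])
    show "a < b + \<delta>" using \<open>a < b\<close> \<open>\<delta> > 0\<close> by simp
    show "mono_on {a..b+\<delta>} m"
    proof (rule mono_onI)
      fix u v assume uv: "u \<in> {a..b+\<delta>}" "v \<in> {a..b+\<delta>}" "u \<le> v"
      show "m u \<le> m v"
        using m[OF uv(1)] m[OF uv(2)] uv(3) less[of "m v" "m u"] by force
    qed
    show "m ` {a..b+\<delta>} = {a..b}"
    proof (intro equalityI subsetI)
      fix t assume t: "t \<in> {a..b}"
      have "l t \<in> {u\<in>{a..b+\<delta>}. m u = t}" unfolding fib[OF t] using le by simp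
      then show "t \<in> m ` {a..b+\<delta>}" by force
    qed (use m in blast)
    show "{u\<in>{a..b+\<delta>}. m u = t} = {l t..r t}" if "t \<in> {a..b}" for t by (rule fib[OF that])
    show "l t < r t \<longleftrightarrow> t \<in> marks b P" for t using mark \<open>P \<noteq> {}\<close> by (simp add: marks_def)
    fix t u assume t: "t \<in> {a..b}" and u: "u \<in> {l t..r t}"
    have uI: "u \<in> {a..b+\<delta>}" using fib[OF t] u by blast
    show "?h u = \<phi> t ((u - l t) / (r t - l t))"
    proof (cases "u = r t")
      case True
      have "(THE s. s \<in> {a..b} \<and> u = tau P e \<delta> s) = t"
      proof (rule the_equality)
        fix s assume "s \<in> {a..b} \<and> u = tau P e \<delta> s"
        then show "s = t" using unique[OF _ u, of s] le[of s] by (simp add: r_def)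
      qed (use t True in \<open>simp add: r_def\<close>)
      moreover have "\<exists>s\<in>{a..b}. u = tau P e \<delta> s" using t True by (auto simp: r_def)
      ultimately have "?h u = \<phi> t 1"
        using uI \<open>P \<noteq> {}\<close> by (simp add: delta_extension_def)
      also have "\<dots> = \<phi> t ((u - l t) / (r t - l t))"
      proof (cases "l t = r t")
        case False
        then show ?thesis using True by simp
      next
        case eq: True
        then have "t \<notin> P" using mark[of t] by simp
        then show ?thesis using decorated_pairsD(5)[OF dec t, of 1 0] eq by simp
      qed
      finally show ?thesis .
    next
      case False
      then have "t \<in> P" using u mark[of t] by auto
      then obtain j where j: "j \<in> N" "t = e j" using bij by (auto simp: bij_betw_def)
      have "\<not> (\<exists>s\<in>{a..b}. u = tau P e \<delta> s)"
      proof
        assume "\<exists>s\<in>{a..b}. u = tau P e \<delta> s"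
        then obtain s where "u = r s" by (auto simp: r_def)
        then show False using unique[OF _ u, of s] le[of s] False by simp
      qed
      moreover have "(THE j. j \<in> index_set P \<and> tau_left a P e \<delta> (e j) \<le> u \<and> u < tau P e \<delta> (e j)) = j"
      proof (rule the_equality)
        fix i assume i: "i \<in> index_set P \<and> tau_left a P e \<delta> (e i) \<le> u \<and> u < tau P e \<delta> (e i)"
        then have "e i = t" using unique[OF _ u, of "e i"] by (simp add: tau_left r_def)
        then show "i = j"
          using i j bij_betw_imp_inj_on[OF bij] by (auto simp: inj_on_def N_def)
      qed (use j u False in \<open>auto simp: tau_left r_def N_def\<close>)
      moreover have "width P \<delta> j = r t - l t" using jump[OF j(1)] j(2) by (simp add: w_def)
      ultimately show ?thesis
        using uI \<open>P \<noteq> {}\<close> j(2) by (simp add: delta_extension_def tau_left)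
    qed
  qed
  moreover have "\<bar>m u - u\<bar> \<le> \<delta>" if "u \<in> {a..b+\<delta>}" for u
    using m[OF that] near[of "m u"] by auto
  ultimately show ?thesis by (rule that)
qed

lemma delta_extension_presents:
  fixes \<phi> :: "real \<Rightarrow> real \<Rightarrow> 'a::real_normed_vector"
  assumes "a < b" and dec: "(\<phi>, P) \<in> decorated_pairs a b" and e: "enumerates e P" and "\<delta> > 0"
  obtains m where "presents a b (\<phi>, P) (b + \<delta>, m, delta_extension a b \<phi> P e \<delta>)"
    and "\<And>u. u \<in> {a..b+\<delta>} \<Longrightarrow> \<bar>m u - u\<bar> \<le> \<delta>"
proof (cases "P = {}")
  case False
  then show ?thesis using delta_extension_presents_nonempty assms that by blast
next
  case True
  have const: "\<phi> t s = \<phi> t 1" if "t \<in> {a..b}" "s \<in> {0..1}" for t s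
    using decorated_pairsD(5)[OF dec that(1) _ that(2)] True by simp
  have "presents a b (\<phi>, P) (b + \<delta>, \<lambda>u. min u b, delta_extension a b \<phi> P e \<delta>)"
  proof (rule presentsI[where l = "\<lambda>t. t" and r = "\<lambda>t. if t = b then b + \<delta> else t"])
    show "(\<lambda>u. min u b) ` {a..b+\<delta>} = {a..b}"
    proof (intro equalityI subsetI)
      fix t assume "t \<in> {a..b}"
      then show "t \<in> (\<lambda>u. min u b) ` {a..b+\<delta>}" using \<open>\<delta> > 0\<close> by (intro image_eqI[of _ _ t]) auto
    qed (use \<open>a < b\<close> in auto)
    fix t u assume t: "t \<in> {a..b}" and u: "u \<in> {t..if t = b then b + \<delta> else t}"
    have "min u b = t" "u \<in> {a..b+\<delta>}" using t u \<open>\<delta> > 0\<close> by (auto split: if_splits)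
    then have "delta_extension a b \<phi> P e \<delta> u = \<phi> t 1" by (simp add: delta_extension_def True)
    also have "\<dots> = \<phi> t ((u - t) / ((if t = b then b + \<delta> else t) - t))"
      using u \<open>\<delta> > 0\<close> by (intro const[OF t, symmetric]) (auto split: if_splits)
    finally show "delta_extension a b \<phi> P e \<delta> u
      = \<phi> t ((u - t) / ((if t = b then b + \<delta> else t) - t))" .
  qed (use \<open>a < b\<close> \<open>\<delta> > 0\<close> in \<open>auto simp: marks_def True intro!: mono_onI\<close>)
  moreover have "\<bar>min u b - u\<bar> \<le> \<delta>" if "u \<in> {a..b+\<delta>}" for u using that \<open>\<delta> > 0\<close> by auto
  ultimately show ?thesis by (rule that)
qed

section \<open>The distance of decorated paths\<close>

lemma enumerates_exists:
  assumes "countable P"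
  obtains e where "enumerates e P"
proof (cases "finite P")
  case True
  then show ?thesis
    using ex_bij_betw_nat_finite_1 that by (fastforce simp: enumerates_def index_set_def)
next
  case False
  with assms obtain f :: "real \<Rightarrow> nat" where "bij_betw f P UNIV" by (rule countableE_infinite)
  then have "bij_betw (inv_into P f) UNIV P" by (rule bij_betw_inv_into)
  moreover have "bij_betw (\<lambda>n::nat. n - 1) {1..} UNIV"
    by (rule bij_betw_byWitness[where f' = Suc]) auto
  ultimately have "bij_betw (inv_into P f \<circ> (\<lambda>n. n - 1)) {1..} P" by (rule bij_betw_trans[rotated])
  then show ?thesis using that False by (simp add: enumerates_def index_set_def)
qed

lemma affine_reparam:
  fixes a c d :: real
  assumes "a < c" "a < d"
  shows "strict_mono_on {a..d} (\<lambda>u. a + (u - a) * ((c - a) / (d - a)))"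
    and "(\<lambda>u. a + (u - a) * ((c - a) / (d - a))) ` {a..d} = {a..c}"
proof -
  have "(c - a) / (d - a) > 0" using assms by simp
  then show "strict_mono_on {a..d} (\<lambda>u. a + (u - a) * ((c - a) / (d - a)))"
    by (intro strict_mono_onI add_strict_left_mono mult_strict_right_mono) auto
  show "(\<lambda>u. a + (u - a) * ((c - a) / (d - a))) ` {a..d} = {a..c}"
  proof (intro equalityI subsetI)
    fix y assume "y \<in> (\<lambda>u. a + (u - a) * ((c - a) / (d - a))) ` {a..d}"
    then obtain u where u: "u \<in> {a..d}" "y = a + (u - a) * ((c - a) / (d - a))" by blast
    have "(u - a) * ((c - a) / (d - a)) \<le> (d - a) * ((c - a) / (d - a))"
      using u assms by (intro mult_right_mono) auto
    moreover have "0 \<le> (u - a) * ((c - a) / (d - a))"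
      using u assms by (intro mult_nonneg_nonneg) auto
    ultimately show "y \<in> {a..c}" using u assms by simp
  next
    fix y assume y: "y \<in> {a..c}"
    have "(y - a) * ((d - a) / (c - a)) \<le> (c - a) * ((d - a) / (c - a))"
      using y assms by (intro mult_right_mono) auto
    moreover have "0 \<le> (y - a) * ((d - a) / (c - a))"
      using y assms by (intro mult_nonneg_nonneg) auto
    ultimately show "y \<in> (\<lambda>u. a + (u - a) * ((c - a) / (d - a))) ` {a..d}"
      using assms by (intro image_eqI[of _ _ "a + (y - a) * ((d - a) / (c - a))"]) auto
  qed
qed

lemma presents_matches_exists:
  fixes x y :: "(real \<Rightarrow> real \<Rightarrow> 'a::real_normed_vector) \<times> real set"
  assumes dec: "x \<in> decorated_pairs a b" "y \<in> decorated_pairs a b"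
    and pres: "presents a b x X" "presents a b y Y"
  shows "\<exists>r. matches a r X Y"
proof (cases x; cases y; cases X; cases Y)
  fix \<phi>1 P1 \<phi>2 P2 d1 m1 d2 m2 and h1 h2 :: "real \<Rightarrow> 'a"
  assume eq: "x = (\<phi>1, P1)" "y = (\<phi>2, P2)" "X = (d1, m1, h1)" "Y = (d2, m2, h2)"
  note X = pres(1)[unfolded eq] and Y = pres(2)[unfolded eq]
  have 1: "a < d1" "\<And>u. u \<in> {a..d1} \<Longrightarrow> m1 u \<in> {a..b}" by (rule presentsE[OF X]; blast)+
  have 2: "a < d2" "\<And>u. u \<in> {a..d2} \<Longrightarrow> m2 u \<in> {a..b}" by (rule presentsE[OF Y]; blast)+
  have "bounded (h1 ` {a..d1})" "bounded (h2 ` {a..d2})"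
    using presents_cadlag[OF dec(1)[unfolded eq] X] presents_cadlag[OF dec(2)[unfolded eq] Y]
      cadlag_on_bounded by blast+
  then obtain B1 B2 where B: "\<And>u. u \<in> {a..d1} \<Longrightarrow> norm (h1 u) \<le> B1"
    "\<And>u. u \<in> {a..d2} \<Longrightarrow> norm (h2 u) \<le> B2"
    unfolding bounded_iff by (metis imageI)
  note aff = affine_reparam[OF 1(1) 2(1)]
  have "matches a (max (b - a) (B1 + B2)) (d1, m1, h1) (d2, m2, h2)"
  proof (rule matchesI[OF aff])
    fix u assume u: "u \<in> {a..d2}"
    let ?v = "a + (u - a) * ((d1 - a) / (d2 - a))"
    have v: "?v \<in> {a..d1}" using aff(2) u by blast
    show "\<bar>m1 ?v - m2 u\<bar> \<le> max (b - a) (B1 + B2)" using 1(2)[OF v] 2(2)[OF u] by auto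
    show "norm (h1 ?v - h2 u) \<le> max (b - a) (B1 + B2)"
      using norm_triangle_le_diff[OF add_mono[OF B(1)[OF v] B(2)[OF u]]] by simp
  qed
  then show ?thesis unfolding eq by blast
qed

lemma presents_near:
  fixes x :: "(real \<Rightarrow> real \<Rightarrow> 'a::real_normed_vector) \<times> real set"
  assumes "a < b" "x \<in> decorated_pairs a b" "\<delta> > 0"
  obtains m h where "presents a b x (b + \<delta>, m, h)"
    and "\<And>u. u \<in> {a..b+\<delta>} \<Longrightarrow> \<bar>m u - u\<bar> \<le> \<delta>"
proof (cases x)
  case (Pair \<phi> P)
  have dec: "(\<phi>, P) \<in> decorated_pairs a b" using assms Pair by simp
  obtain e where "enumerates e P" using enumerates_exists[OF decorated_pairsD(4)[OF dec]] .
  then obtain m where "presents a b (\<phi>, P) (b + \<delta>, m, delta_extension a b \<phi> P e \<delta>)"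
    and "\<And>u. u \<in> {a..b+\<delta>} \<Longrightarrow> \<bar>m u - u\<bar> \<le> \<delta>"
    using delta_extension_presents[OF \<open>a < b\<close> dec _ \<open>\<delta> > 0\<close>] by blast
  then show ?thesis using that Pair by blast
qed

lemma presents_domain_nonempty: "presents a b x (d, m, h) \<Longrightarrow> a < d"
  by (cases x) (auto simp: presents_def)

text \<open>By uniqueness of presentations every matching of \<open>X\<close> and \<open>Y\<close> gives one of the two extensions, and
replacing their clocks by the identity costs \<open>2 * \<delta>\<close>.\<close>

lemma J1_dist_delta_extension:
  fixes \<phi>1 \<phi>2 :: "real \<Rightarrow> real \<Rightarrow> 'a::real_normed_vector"
  assumes "a < b" and dec: "(\<phi>1, P1) \<in> decorated_pairs a b" "(\<phi>2, P2) \<in> decorated_pairs a b"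
    and X: "presents a b (\<phi>1, P1) X" and Y: "presents a b (\<phi>2, P2) Y"
    and e: "enumerates e1 P1" "enumerates e2 P2" and "\<delta> > 0"
  defines "f1 \<equiv> delta_extension a b \<phi>1 P1 e1 \<delta>" and "f2 \<equiv> delta_extension a b \<phi>2 P2 e2 \<delta>"
  shows "matches a r X Y \<Longrightarrow> J1_dist {a..b+\<delta>} f1 f2 \<le> r + 2 * \<delta>"
    and "J1_dist {a..b+\<delta>} f1 f2 < r \<Longrightarrow> matches a (r + 2 * \<delta>) X Y"
proof -
  obtain m1 where X1: "presents a b (\<phi>1, P1) (b + \<delta>, m1, f1)"
    and m1: "\<And>u. u \<in> {a..b+\<delta>} \<Longrightarrow> \<bar>m1 u - u\<bar> \<le> \<delta>"
    using delta_extension_presents[OF \<open>a < b\<close> dec(1) e(1) \<open>\<delta> > 0\<close>] unfolding f1_def by blast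
  obtain m2 where Y2: "presents a b (\<phi>2, P2) (b + \<delta>, m2, f2)"
    and m2: "\<And>u. u \<in> {a..b+\<delta>} \<Longrightarrow> \<bar>m2 u - u\<bar> \<le> \<delta>"
    using delta_extension_presents[OF \<open>a < b\<close> dec(2) e(2) \<open>\<delta> > 0\<close>] unfolding f2_def by blast
  have XX: "matches a 0 (b + \<delta>, m1, f1) X" and YY: "matches a 0 Y (b + \<delta>, m2, f2)"
    using X X1 Y Y2 by (cases X; cases Y; blast intro: presents_unique)+
  show "J1_dist {a..b+\<delta>} f1 f2 \<le> r + 2 * \<delta>" if "matches a r X Y"
  proof (rule J1_dist_le)
    have "matches a r (b + \<delta>, m1, f1) (b + \<delta>, m2, f2)"
      using matches_trans[OF XX matches_trans[OF that YY]] by simp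
    then show "matches a (r + 2 * \<delta>) (b + \<delta>, \<lambda>u. u, f1) (b + \<delta>, \<lambda>u. u, f2)"
      by (rule matches_retime) (use m1 m2 \<open>\<delta> > 0\<close> in \<open>auto simp: abs_minus_commute\<close>)
  qed (use \<open>a < b\<close> \<open>\<delta> > 0\<close> in simp)
  show "matches a (r + 2 * \<delta>) X Y" if "J1_dist {a..b+\<delta>} f1 f2 < r"
  proof -
    have "bounded (f1 ` {a..b+\<delta>})" "bounded (f2 ` {a..b+\<delta>})"
      using presents_cadlag[OF dec(1) X1] presents_cadlag[OF dec(2) Y2] cadlag_on_bounded by blast+
    then have "matches a r (b + \<delta>, \<lambda>u. u, f1) (b + \<delta>, \<lambda>u. u, f2)"
      using that by (rule matches_if_J1_dist_less)
    then have "matches a (r + 2 * \<delta>) (b + \<delta>, m1, f1) (b + \<delta>, m2, f2)"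
      by (rule matches_retime) (use m1 m2 \<open>\<delta> > 0\<close> in auto)
    then show ?thesis
      using matches_trans[OF matches_sym[OF XX] matches_trans[OF _ matches_sym[OF YY]]] by simp
  qed
qed

text \<open>The J1 distance of the extensions lies within \<open>2 * \<delta>\<close> of the infimum, which does not depend on
\<open>\<delta>\<close> or on the enumerations. Hence the limit that defines \<open>alpha\<close> exists and equals the infimum.\<close>

lemma alpha_eq_Inf_matches:
  fixes x y :: "(real \<Rightarrow> real \<Rightarrow> 'a::real_normed_vector) \<times> real set"
  assumes "a < b" and dec: "x \<in> decorated_pairs a b" "y \<in> decorated_pairs a b"
    and pres: "presents a b x X" "presents a b y Y"
  shows "alpha a b x y = Inf {r. matches a r X Y}"
proof (cases x; cases y)
  fix \<phi>1 P1 \<phi>2 P2 assume eq: "x = (\<phi>1, P1)" "y = (\<phi>2, P2)"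
  define R where "R = {r. matches a r X Y}"
  note dec' = dec[unfolded eq] and pres' = pres[unfolded eq]
  have ne: "R \<noteq> {}" unfolding R_def using presents_matches_exists[OF dec pres] by blast
  have "0 \<le> r" if "r \<in> R" for r
    using that pres(2) unfolding R_def
    by (cases Y) (auto dest: presents_domain_nonempty intro: matches_nonneg less_imp_le)
  then have bdd: "bdd_below R" by (rule bdd_belowI)
  have above: "matches a r X Y" if "Inf R < r" for r
    using cInf_lessD[OF ne that] by (auto simp: R_def intro: matches_mono)
  let ?J = "\<lambda>e1 e2 \<delta>. J1_dist {a..b+\<delta>} (delta_extension a b \<phi>1 P1 e1 \<delta>) (delta_extension a b \<phi>2 P2 e2 \<delta>)"
  have lim: "(?J e1 e2 \<longlongrightarrow> Inf R) (at_right 0)" if e: "enumerates e1 P1" "enumerates e2 P2" for e1 e2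
  proof (rule tendsto_sandwich)
    have "?J e1 e2 \<delta> \<le> Inf R + 2 * \<delta>" if "\<delta> > 0" for \<delta>
    proof (rule field_le_epsilon)
      fix \<epsilon> :: real assume "\<epsilon> > 0"
      then have "matches a (Inf R + \<epsilon>) X Y" by (intro above) simp
      from J1_dist_delta_extension(1)[OF \<open>a < b\<close> dec' pres' e \<open>\<delta> > 0\<close> this]
      show "?J e1 e2 \<delta> \<le> Inf R + 2 * \<delta> + \<epsilon>" by simp
    qed
    then show "\<forall>\<^sub>F \<delta> in at_right 0. ?J e1 e2 \<delta> \<le> Inf R + 2 * \<delta>" by (simp add: eventually_at_filter)
    have "Inf R - 2 * \<delta> \<le> ?J e1 e2 \<delta>" if "\<delta> > 0" for \<delta>
    proof (rule field_le_epsilon)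
      fix \<epsilon> :: real assume "\<epsilon> > 0"
      then have "matches a (?J e1 e2 \<delta> + \<epsilon> + 2 * \<delta>) X Y"
        by (intro J1_dist_delta_extension(2)[OF \<open>a < b\<close> dec' pres' e \<open>\<delta> > 0\<close>]) simp
      then have "Inf R \<le> ?J e1 e2 \<delta> + \<epsilon> + 2 * \<delta>" by (intro cInf_lower bdd) (simp add: R_def)
      then show "Inf R - 2 * \<delta> \<le> ?J e1 e2 \<delta> + \<epsilon>" by simp
    qed
    then show "\<forall>\<^sub>F \<delta> in at_right 0. Inf R - 2 * \<delta> \<le> ?J e1 e2 \<delta>" by (simp add: eventually_at_filter)
    show "((\<lambda>\<delta>. Inf R - 2 * \<delta>) \<longlongrightarrow> Inf R) (at_right 0)" by (rule tendsto_eq_intros refl | simp)+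
    show "((\<lambda>\<delta>. Inf R + 2 * \<delta>) \<longlongrightarrow> Inf R) (at_right 0)" by (rule tendsto_eq_intros refl | simp)+
  qed
  obtain e1 where e1: "enumerates e1 P1" by (rule enumerates_exists[OF decorated_pairsD(4)[OF dec'(1)]])
  obtain e2 where e2: "enumerates e2 P2" by (rule enumerates_exists[OF decorated_pairsD(4)[OF dec'(2)]])
  show ?thesis
    unfolding alpha_def eq prod.case R_def[symmetric]
  proof (rule the_equality)
    fix L assume L: "\<forall>e1 e2. enumerates e1 P1 \<longrightarrow> enumerates e2 P2 \<longrightarrow> (?J e1 e2 \<longlongrightarrow> L) (at_right 0)"
    then have "(?J e1 e2 \<longlongrightarrow> L) (at_right 0)" using e1 e2 by blast
    from tendsto_unique[OF trivial_limit_at_right_real this lim[OF e1 e2]] show "L = Inf R" .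
  qed (use lim in blast)
qed

lemma alpha_le:
  fixes x y :: "(real \<Rightarrow> real \<Rightarrow> 'a::real_normed_vector) \<times> real set"
  assumes "a < b" and dec: "x \<in> decorated_pairs a b" "y \<in> decorated_pairs a b"
    and pres: "presents a b x X" "presents a b y Y" and r: "matches a r X Y"
  shows "alpha a b x y \<le> r"
  unfolding alpha_eq_Inf_matches[OF assms(1-5)]
proof (rule cInf_lower)
  show "bdd_below {r. matches a r X Y}"
    using pres(2)
    by (intro bdd_belowI[of _ 0], cases Y)
      (auto dest: presents_domain_nonempty intro: matches_nonneg less_imp_le)
qed (use r in simp)

lemma matches_if_alpha_less:
  fixes x y :: "(real \<Rightarrow> real \<Rightarrow> 'a::real_normed_vector) \<times> real set"
  assumes "a < b" and dec: "x \<in> decorated_pairs a b" "y \<in> decorated_pairs a b"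
    and pres: "presents a b x X" "presents a b y Y" and r: "alpha a b x y < r"
  shows "matches a r X Y"
  using cInf_lessD[OF _ r[unfolded alpha_eq_Inf_matches[OF assms(1-5)]]]
    presents_matches_exists[OF dec pres] by (auto intro: matches_mono)

lemma presents_some:
  fixes x :: "(real \<Rightarrow> real \<Rightarrow> 'a::real_normed_vector) \<times> real set"
  assumes "a < b" "x \<in> decorated_pairs a b"
  obtains X where "presents a b x X"
  using presents_near[OF assms zero_less_one] by metis

lemma alpha_nonneg:
  fixes x y :: "(real \<Rightarrow> real \<Rightarrow> 'a::real_normed_vector) \<times> real set"
  assumes "a < b" and dec: "x \<in> decorated_pairs a b" "y \<in> decorated_pairs a b"
  shows "0 \<le> alpha a b x y"
proof (rule ccontr)
  assume "\<not> 0 \<le> alpha a b x y"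
  then obtain r where r: "alpha a b x y < r" "r < 0"
    using dense[of "alpha a b x y" 0] by auto
  obtain X where X: "presents a b x X" by (rule presents_some[OF assms(1,2)])
  obtain d m h where Y: "presents a b y (d, m, h)"
    by (rule presents_some[OF assms(1,3)]) (metis prod_cases3)
  have "0 \<le> r"
    using matches_nonneg[OF matches_if_alpha_less[OF assms X Y r(1)]] presents_domain_nonempty[OF Y]
    by simp
  with r show False by simp
qed

lemma alpha_refl:
  fixes x :: "(real \<Rightarrow> real \<Rightarrow> 'a::real_normed_vector) \<times> real set"
  assumes "a < b" "x \<in> decorated_pairs a b"
  shows "alpha a b x x = 0"
proof -
  obtain X where X: "presents a b x X" by (rule presents_some[OF assms])
  have "alpha a b x x \<le> 0" by (rule alpha_le[OF assms assms(2) X X matches_refl]) simp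
  with alpha_nonneg[OF assms assms(2)] show ?thesis by simp
qed

lemma alpha_sym:
  fixes x y :: "(real \<Rightarrow> real \<Rightarrow> 'a::real_normed_vector) \<times> real set"
  assumes "a < b" and dec: "x \<in> decorated_pairs a b" "y \<in> decorated_pairs a b"
  shows "alpha a b x y = alpha a b y x"
proof -
  obtain X where X: "presents a b x X" by (rule presents_some[OF assms(1,2)])
  obtain Y where Y: "presents a b y Y" by (rule presents_some[OF assms(1,3)])
  have "matches a r X Y \<longleftrightarrow> matches a r Y X" for r using matches_sym by blast
  then show ?thesis
    by (simp add: alpha_eq_Inf_matches[OF assms X Y] alpha_eq_Inf_matches[OF assms(1,3,2) Y X])
qed

lemma alpha_triangle:
  fixes x y z :: "(real \<Rightarrow> real \<Rightarrow> 'a::real_normed_vector) \<times> real set"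
  assumes "a < b" and dec: "x \<in> decorated_pairs a b" "y \<in> decorated_pairs a b" "z \<in> decorated_pairs a b"
  shows "alpha a b x z \<le> alpha a b x y + alpha a b y z"
proof (rule field_le_epsilon)
  fix \<epsilon> :: real assume "\<epsilon> > 0"
  obtain X where X: "presents a b x X" by (rule presents_some[OF assms(1,2)])
  obtain Y where Y: "presents a b y Y" by (rule presents_some[OF assms(1,3)])
  obtain Z where Z: "presents a b z Z" by (rule presents_some[OF assms(1,4)])
  have "matches a (alpha a b x y + \<epsilon>/2) X Y"
    by (rule matches_if_alpha_less[OF assms(1-3) X Y]) (use \<open>\<epsilon> > 0\<close> in simp)
  moreover have "matches a (alpha a b y z + \<epsilon>/2) Y Z"
    by (rule matches_if_alpha_less[OF assms(1,3,4) Y Z]) (use \<open>\<epsilon> > 0\<close> in simp)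
  ultimately have "matches a (alpha a b x y + \<epsilon>/2 + (alpha a b y z + \<epsilon>/2)) X Z"
    by (rule matches_trans)
  from alpha_le[OF assms(1,2,4) X Z this]
  show "alpha a b x z \<le> alpha a b x y + alpha a b y z + \<epsilon>" by simp
qed

section \<open>The metric on classes\<close>

lemma equiv_alpha_rel:
  assumes "a < b"
  shows "equiv (decorated_pairs a b) (alpha_rel a b ::
    (((real \<Rightarrow> real \<Rightarrow> 'a::real_normed_vector) \<times> real set) \<times> _) set)"
proof (rule equivI)
  show "alpha_rel a b \<subseteq> decorated_pairs a b \<times> decorated_pairs a b" by (auto simp: alpha_rel_def)
  show "refl_on (decorated_pairs a b) (alpha_rel a b)"
    by (auto simp: refl_on_def alpha_rel_def alpha_refl[OF assms])
  show "sym (alpha_rel a b)"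
    by (rule symI) (auto simp: alpha_rel_def alpha_sym[OF assms])
  show "trans (alpha_rel a b)"
  proof (rule transI)
    fix x y z assume "(x, y) \<in> alpha_rel a b" "(y, z) \<in> alpha_rel a b"
    then show "(x, z) \<in> alpha_rel a b"
      using alpha_triangle[OF assms, of x y z] alpha_nonneg[OF assms, of x z]
      by (auto simp: alpha_rel_def)
  qed
qed

lemma alpha_dist_class:
  fixes x y :: "(real \<Rightarrow> real \<Rightarrow> 'a::real_normed_vector) \<times> real set"
  assumes "a < b" and dec: "x \<in> decorated_pairs a b" "y \<in> decorated_pairs a b"
  shows "alpha_dist a b (alpha_rel a b `` {x}) (alpha_rel a b `` {y}) = alpha a b x y"
proof -
  have eq: "alpha a b x' y' = alpha a b x y"
    if "x' \<in> alpha_rel a b `` {x}" "y' \<in> alpha_rel a b `` {y}" for x' y'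
  proof -
    have *: "x' \<in> decorated_pairs a b" "y' \<in> decorated_pairs a b" "alpha a b x x' = 0" "alpha a b y y' = 0"
      using that by (auto simp: alpha_rel_def)
    show ?thesis
      using alpha_triangle[OF \<open>a < b\<close> dec(1) *(1) dec(2)] alpha_triangle[OF \<open>a < b\<close> *(1,2) dec(2)]
        alpha_triangle[OF \<open>a < b\<close> *(1) dec(1) *(2)] alpha_triangle[OF \<open>a < b\<close> dec *(2)]
        alpha_sym[OF \<open>a < b\<close> dec(1) *(1)] alpha_sym[OF \<open>a < b\<close> dec(2) *(2)] *(3,4)
      by linarith
  qed
  have self: "x \<in> alpha_rel a b `` {x}" "y \<in> alpha_rel a b `` {y}"
    using equiv_class_self[OF equiv_alpha_rel[OF \<open>a < b\<close>]] dec by blast+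
  have "(THE r. \<forall>x'\<in>alpha_rel a b `` {x}. \<forall>y'\<in>alpha_rel a b `` {y}. alpha a b x' y' = r) = alpha a b x y"
  proof (rule the_equality)
    fix r assume "\<forall>x'\<in>alpha_rel a b `` {x}. \<forall>y'\<in>alpha_rel a b `` {y}. alpha a b x' y' = r"
    then have "alpha a b x y = r" using self by blast
    then show "r = alpha a b x y" ..
  qed (use eq in blast)
  then show ?thesis
    using dec by (simp add: alpha_dist_def decorated_space_def quotientI)
qed

lemma decorated_spaceE:
  assumes "X \<in> decorated_space a b"
  obtains x where "x \<in> decorated_pairs a b" "X = alpha_rel a b `` {x}"
  using assms unfolding decorated_space_def by (rule quotientE)

lemma decorated_Metric_space:
  assumes "a < b"
  shows "Metric_space (decorated_space a b ::
    ((real \<Rightarrow> real \<Rightarrow> 'a::real_normed_vector) \<times> real set) set set) (alpha_dist a b)"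
proof
  fix X Y :: "((real \<Rightarrow> real \<Rightarrow> 'a) \<times> real set) set"
  show "0 \<le> alpha_dist a b X Y"
  proof (cases "X \<in> decorated_space a b \<and> Y \<in> decorated_space a b")
    case True
    then show ?thesis
      by (auto elim!: decorated_spaceE simp: alpha_dist_class[OF assms] alpha_nonneg[OF assms])
  qed (auto simp: alpha_dist_def)
  show "alpha_dist a b X Y = alpha_dist a b Y X"
  proof (cases "X \<in> decorated_space a b \<and> Y \<in> decorated_space a b")
    case True
    then show ?thesis
      by (auto elim!: decorated_spaceE simp: alpha_dist_class[OF assms] alpha_sym[OF assms])
  qed (auto simp: alpha_dist_def)
next
  fix X Y :: "((real \<Rightarrow> real \<Rightarrow> 'a) \<times> real set) set"
  assume "X \<in> decorated_space a b" "Y \<in> decorated_space a b"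
  then obtain x y where x: "x \<in> decorated_pairs a b" "X = alpha_rel a b `` {x}"
    and y: "y \<in> decorated_pairs a b" "Y = alpha_rel a b `` {y}"
    by (metis decorated_spaceE)
  have "alpha_dist a b X Y = alpha a b x y"
    unfolding x(2) y(2) by (rule alpha_dist_class[OF assms x(1) y(1)])
  moreover have "X = Y \<longleftrightarrow> (x, y) \<in> alpha_rel a b"
    unfolding x(2) y(2) by (rule eq_equiv_class_iff[OF equiv_alpha_rel[OF assms] x(1) y(1)])
  ultimately show "(alpha_dist a b X Y = 0) = (X = Y)" using x(1) y(1) by (simp add: alpha_rel_def)
next
  fix X Y Z :: "((real \<Rightarrow> real \<Rightarrow> 'a) \<times> real set) set"
  assume "X \<in> decorated_space a b" "Y \<in> decorated_space a b" "Z \<in> decorated_space a b"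
  then show "alpha_dist a b X Z \<le> alpha_dist a b X Y + alpha_dist a b Y Z"
    by (auto elim!: decorated_spaceE simp: alpha_dist_class[OF assms] intro: alpha_triangle[OF assms])
qed

section \<open>Completeness\<close>

text \<open>Every Cauchy sequence has a subsequence whose successive distances decay geometrically.\<close>

lemma (in Metric_space) mcomplete_if_fast_sequences_converge:
  assumes conv: "\<And>\<sigma>. \<lbrakk>range \<sigma> \<subseteq> M; \<And>n. d (\<sigma> n) (\<sigma> (Suc n)) < (1/2) ^ n\<rbrakk>
    \<Longrightarrow> \<exists>x. limitin mtopology \<sigma> x sequentially"
  shows mcomplete
  unfolding mcomplete_def
proof (intro allI impI)
  fix \<sigma> assume \<sigma>: "MCauchy \<sigma>"
  then have "\<forall>k. \<exists>N. \<forall>n n'. N \<le> n \<longrightarrow> N \<le> n' \<longrightarrow> d (\<sigma> n) (\<sigma> n') < (1/2) ^ k"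
    by (simp add: MCauchy_def)
  then obtain N where N: "\<And>k n n'. N k \<le> n \<Longrightarrow> N k \<le> n' \<Longrightarrow> d (\<sigma> n) (\<sigma> n') < (1/2) ^ k" by metis
  \<comment> \<open>The sum exceeds \<open>N k\<close>, and the summand \<open>k\<close> makes \<open>r\<close> strictly increasing.\<close>
  define r where "r k = (\<Sum>i\<le>k. N i) + k" for k
  have mono: "strict_mono r" by (rule strict_monoI_Suc) (simp add: r_def)
  have "N k \<le> r k" for k
    using member_le_sum[of k "{..k}" N] by (simp add: r_def)
  then have "d ((\<sigma> \<circ> r) k) ((\<sigma> \<circ> r) (Suc k)) < (1/2) ^ k" for k
    using strict_mono_less_eq[OF mono, of k "Suc k"] by (auto intro!: N intro: order_trans)
  moreover have "range (\<sigma> \<circ> r) \<subseteq> M" using \<sigma> by (auto simp: MCauchy_def)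
  ultimately obtain x where "limitin mtopology (\<sigma> \<circ> r) x sequentially" using conv by blast
  then show "\<exists>x. limitin mtopology \<sigma> x sequentially"
    using MCauchy_convergent_subsequence[OF \<sigma> mono] by blast
qed

lemma fast_sequence_limit:
  fixes f :: "nat \<Rightarrow> 'a::banach"
  assumes f: "\<And>n. norm (f (Suc n) - f n) \<le> (1/2) ^ n"
  shows "\<exists>g. \<forall>n. norm (f n - g) \<le> 2 * (1/2) ^ n"
proof -
  have step: "norm (f (n + k) - f n) \<le> 2 * (1/2) ^ n - 2 * (1/2) ^ (n + k)" for n k
  proof (induction k)
    case (Suc k)
    have "norm (f (n + Suc k) - f n) \<le> norm (f (Suc (n + k)) - f (n + k)) + norm (f (n + k) - f n)"
      using norm_triangle_ineq[of "f (Suc (n + k)) - f (n + k)" "f (n + k) - f n"] by simp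
    also have "\<dots> \<le> (1/2) ^ (n + k) + (2 * (1/2) ^ n - 2 * (1/2) ^ (n + k))"
      using f[of "n + k"] Suc.IH by linarith
    also have "\<dots> = 2 * (1/2) ^ n - 2 * (1/2) ^ (n + Suc k)" by simp
    finally show ?case .
  qed simp
  have tail: "norm (f k - f n) \<le> 2 * (1/2) ^ n" if "n \<le> k" for n k
  proof -
    have "norm (f k - f n) \<le> 2 * (1/2) ^ n - 2 * (1/2) ^ k" using step[of n "k - n"] that by simp
    also have "\<dots> \<le> 2 * (1/2) ^ n" by simp
    finally show ?thesis .
  qed
  have "Cauchy f"
  proof (rule metric_CauchyI)
    fix e :: real assume "e > 0"
    then obtain n where n: "(1/2::real) ^ n < e / 4" using real_arch_pow_inv[of "e/4" "1/2"] by auto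
    have "dist (f i) (f j) < e" if "i \<ge> n" "j \<ge> n" for i j
      using dist_triangle2[of "f i" "f j" "f n"] tail[OF that(1)] tail[OF that(2)] n
      by (simp add: dist_norm)
    then show "\<exists>n. \<forall>i\<ge>n. \<forall>j\<ge>n. dist (f i) (f j) < e" by blast
  qed
  then obtain g where g: "f \<longlonglongrightarrow> g" using Cauchy_convergent convergent_def by blast
  have "norm (f n - g) \<le> 2 * (1/2) ^ n" for n
  proof (rule tendsto_upperbound)
    show "(\<lambda>k. norm (f n - f k)) \<longlonglongrightarrow> norm (f n - g)" by (intro tendsto_intros g)
    show "\<forall>\<^sub>F k in sequentially. norm (f n - f k) \<le> 2 * (1/2) ^ n"
      by (rule eventually_sequentiallyI[of n]) (subst norm_minus_commute, rule tail)
  qed simp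
  then show ?thesis by blast
qed

text \<open>Composing the changes of parameter between successive terms brings all terms onto one parameter
interval, where their clocks and paths converge uniformly. The limit clock is again continuous,
monotone and onto \<open>{a..b}\<close>, and the limit path is cadlag, so after prolonging it the limit presents a
decorated path. Rests may appear in the limit although no term has them at that place: this is how
jumps that accumulate at one time turn into an excursion.\<close>

lemma fast_decorated_sequence_limit:
  fixes x :: "nat \<Rightarrow> (real \<Rightarrow> real \<Rightarrow> 'a::banach) \<times> real set"
  assumes "a < b" and dec: "\<And>n. x n \<in> decorated_pairs a b"
    and fast: "\<And>n. alpha a b (x n) (x (Suc n)) < (1/2) ^ n"
  obtains y where "y \<in> decorated_pairs a b" "\<And>n. alpha a b (x n) y \<le> 3 * (1/2) ^ n"
proof -
  let ?J = "{a..b+1}"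
  have "\<exists>m h. presents a b (x n) (b + 1, m, h)" for n
    using presents_near[OF \<open>a < b\<close> dec zero_less_one] by metis
  then obtain m h where X: "\<And>n. presents a b (x n) (b + 1, m n, h n)" by metis
  have "matches a ((1/2) ^ n) (b + 1, m (Suc n), h (Suc n)) (b + 1, m n, h n)" for n
    by (rule matches_sym[OF matches_if_alpha_less[OF \<open>a < b\<close> dec dec X X fast]])
  then have "\<exists>\<rho>. strict_mono_on ?J \<rho> \<and> \<rho> ` ?J = ?J \<and>
      (\<forall>u\<in>?J. \<bar>m (Suc n) (\<rho> u) - m n u\<bar> \<le> (1/2) ^ n \<and> norm (h (Suc n) (\<rho> u) - h n u) \<le> (1/2) ^ n)" for n
    by (simp add: matches_def)
  then obtain \<rho> where \<rho>: "\<And>n. strict_mono_on ?J (\<rho> n)" "\<And>n. \<rho> n ` ?J = ?J"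
    and \<rho>m: "\<And>n u. u \<in> ?J \<Longrightarrow> \<bar>m (Suc n) (\<rho> n u) - m n u\<bar> \<le> (1/2) ^ n"
    and \<rho>h: "\<And>n u. u \<in> ?J \<Longrightarrow> norm (h (Suc n) (\<rho> n u) - h n u) \<le> (1/2) ^ n"
    by metis
  define s where "s = rec_nat (\<lambda>u. u) (\<lambda>n f u. \<rho> n (f u))"
  have s_simps: "s 0 = (\<lambda>u. u)" "s (Suc n) = (\<lambda>u. \<rho> n (s n u))" for n by (simp_all add: s_def)
  have s: "strict_mono_on ?J (s n) \<and> s n ` ?J = ?J" for n
  proof (induction n)
    case (Suc n)
    then have "s n u \<in> ?J" if "u \<in> ?J" for u using that by blast
    then have "strict_mono_on ?J (s (Suc n))"
      using Suc \<rho>(1)[of n] by (simp add: strict_mono_on_def s_simps)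
    moreover have "s (Suc n) ` ?J = ?J"
      using Suc \<rho>(2)[of n] image_image[of "\<rho> n" "s n" ?J] by (simp add: s_simps)
    ultimately show ?case ..
  qed (simp add: s_simps strict_mono_on_def)
  have s_in: "s n u \<in> ?J" if "u \<in> ?J" for n u using s[of n] that by blast
  have s_cont: "continuous_on ?J (s n)" for n
    using s[of n] by (intro mono_on_surj_continuous_on strict_mono_on_imp_mono_on) auto
  have "\<exists>q g. \<forall>n. norm (m n (s n u) - q) \<le> 2 * (1/2) ^ n \<and> norm (h n (s n u) - g) \<le> 2 * (1/2) ^ n"
    if u: "u \<in> ?J" for u
  proof -
    have "\<exists>q. \<forall>n. norm (m n (s n u) - q) \<le> 2 * (1/2) ^ n"
      by (rule fast_sequence_limit[of "\<lambda>n. m n (s n u)"])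
        (use \<rho>m[OF s_in[OF u]] in \<open>simp add: s_simps\<close>)
    moreover have "\<exists>g. \<forall>n. norm (h n (s n u) - g) \<le> 2 * (1/2) ^ n"
      by (rule fast_sequence_limit[of "\<lambda>n. h n (s n u)"])
        (use \<rho>h[OF s_in[OF u]] in \<open>simp add: s_simps\<close>)
    ultimately show ?thesis by blast
  qed
  then obtain q g where q: "\<And>n u. u \<in> ?J \<Longrightarrow> \<bar>m n (s n u) - q u\<bar> \<le> 2 * (1/2) ^ n"
    and g: "\<And>n u. u \<in> ?J \<Longrightarrow> norm (h n (s n u) - g u) \<le> 2 * (1/2) ^ n"
    by (metis real_norm_def)
  have null: "(\<lambda>n. 2 * (1/2::real) ^ n) \<longlonglongrightarrow> 0"
    by (rule tendsto_mult_right_zero) (rule LIMSEQ_power_zero; simp)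
  have lim_q: "uniform_limit ?J (\<lambda>n u. m n (s n u)) q sequentially"
  proof (rule uniform_limitI)
    fix e :: real assume "e > 0"
    from order_tendstoD(2)[OF null this]
    show "\<forall>\<^sub>F n in sequentially. \<forall>u\<in>?J. dist (m n (s n u)) (q u) < e"
    proof eventually_elim
      case (elim n)
      show ?case
      proof
        fix u assume "u \<in> ?J"
        from q[OF this, of n] elim show "dist (m n (s n u)) (q u) < e" by (simp add: dist_real_def)
      qed
    qed
  qed
  have lim_g: "uniform_limit ?J (\<lambda>n u. h n (s n u)) g sequentially"
  proof (rule uniform_limitI)
    fix e :: real assume "e > 0"
    from order_tendstoD(2)[OF null this]
    show "\<forall>\<^sub>F n in sequentially. \<forall>u\<in>?J. dist (h n (s n u)) (g u) < e"
    proof eventually_elim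
      case (elim n)
      show ?case
      proof
        fix u assume "u \<in> ?J"
        from g[OF this, of n] elim show "dist (h n (s n u)) (g u) < e" by (simp add: dist_norm)
      qed
    qed
  qed
  have mono: "mono_on ?J (m n)" and surj: "m n ` ?J = {a..b}" for n
    using X[of n] by (cases "x n"; auto simp: presents_def)+
  have ms_mono: "mono_on ?J (\<lambda>u. m n (s n u))" for n
  proof (rule mono_onI)
    fix u v assume uv: "u \<in> ?J" "v \<in> ?J" "u \<le> v"
    have "s n u \<le> s n v" using strict_mono_on_leD[of ?J "s n" u v] s[of n] uv by blast
    then show "m n (s n u) \<le> m n (s n v)" by (rule mono_onD[OF mono s_in[OF uv(1)] s_in[OF uv(2)]])
  qed
  have ms_surj: "(\<lambda>u. m n (s n u)) ` ?J = {a..b}" for n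
    using image_image[of "m n" "s n" ?J] s[of n] surj[of n] by simp
  have ms_in: "m n (s n u) \<in> {a..b}" if "u \<in> ?J" for n u using ms_surj[of n] that by blast
  have ends: "m n (s n a) = a" "m n (s n (b + 1)) = b" for n
  proof -
    have "a \<in> (\<lambda>u. m n (s n u)) ` ?J" "b \<in> (\<lambda>u. m n (s n u)) ` ?J"
      unfolding ms_surj using \<open>a < b\<close> by auto
    then obtain u v where "u \<in> ?J" "m n (s n u) = a" "v \<in> ?J" "m n (s n v) = b" by force
    then show "m n (s n a) = a" "m n (s n (b + 1)) = b"
      using mono_onD[OF ms_mono, of a u n] mono_onD[OF ms_mono, of v "b + 1" n]
        ms_in[of a n] ms_in[of "b + 1" n] \<open>a < b\<close> by auto
  qed
  have q_lim: "(\<lambda>n. m n (s n u)) \<longlonglongrightarrow> q u" if "u \<in> ?J" for u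
    by (rule tendsto_uniform_limitI[OF lim_q that])
  have q_mono: "mono_on ?J q"
  proof (rule mono_onI)
    fix u v assume uv: "u \<in> ?J" "v \<in> ?J" "u \<le> v"
    show "q u \<le> q v"
      using mono_onD[OF ms_mono uv] by (intro LIMSEQ_le[OF q_lim[OF uv(1)] q_lim[OF uv(2)]]) auto
  qed
  have q_ends: "q a = a" "q (b + 1) = b"
    using q_lim[of a] q_lim[of "b + 1"] \<open>a < b\<close> by (auto simp: ends LIMSEQ_const_iff)
  have q_cont: "continuous_on ?J q"
  proof (rule uniform_limit_theorem[OF _ lim_q])
    show "\<forall>\<^sub>F n in sequentially. continuous_on ?J (\<lambda>u. m n (s n u))"
      by (intro always_eventually allI mono_on_surj_continuous_on[OF ms_mono ms_surj])
  qed simp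
  have q_surj: "q ` ?J = {a..b}"
  proof (intro equalityI subsetI)
    fix t assume "t \<in> q ` ?J"
    then show "t \<in> {a..b}"
      using mono_onD[OF q_mono, of a] mono_onD[OF q_mono, of _ "b + 1"] q_ends by force
  next
    fix t assume "t \<in> {a..b}"
    then obtain u where "a \<le> u" "u \<le> b + 1" "q u = t"
      using IVT'[of q a t "b + 1"] q_ends q_cont \<open>a < b\<close> by auto
    then show "t \<in> q ` ?J" by force
  qed
  have "cadlag_on ?J (h n)" for n
    using X[of n] dec[of n] by (cases "x n") (simp add: presents_cadlag)
  then have "cadlag_on ?J (\<lambda>u. h n (s n u))" for n
    using s[of n] s_cont
    by (intro cadlag_on_compose_mono[of ?J "h n" ?J "s n"] strict_mono_on_imp_mono_on) auto
  then have g_cadlag: "cadlag_on ?J g" by (rule cadlag_on_uniform_limit[OF _ lim_g])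
  have "a < b + 1" using \<open>a < b\<close> by simp
  obtain y where y: "y \<in> decorated_pairs a b" "presents a b y (prolong a (b + 1, q, g))"
    by (rule prolong_presents_exists[OF \<open>a < b + 1\<close> q_mono q_surj g_cadlag])
  have "alpha a b (x n) y \<le> 3 * (1/2) ^ n" for n
  proof (rule alpha_le[OF \<open>a < b\<close> dec y(1) X y(2)])
    have "matches a (2 * (1/2) ^ n) (b + 1, m n, h n) (b + 1, q, g)"
      using s[of n] q g by (intro matchesI[of _ _ "s n"]) auto
    moreover have "matches a ((1/2) ^ n) (b + 1, q, g) (prolong a (b + 1, q, g))"
      by (rule matches_sym[OF matches_prolong[OF \<open>a < b + 1\<close> q_cont g_cadlag]]) simp
    ultimately have "matches a (2 * (1/2) ^ n + (1/2) ^ n) (b + 1, m n, h n) (prolong a (b + 1, q, g))"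
      by (rule matches_trans)
    then show "matches a (3 * (1/2) ^ n) (b + 1, m n, h n) (prolong a (b + 1, q, g))" by simp
  qed
  with y(1) show ?thesis by (rule that)
qed

lemma decorated_mcomplete:
  assumes "a < b"
  shows "Metric_space.mcomplete (decorated_space a b ::
    ((real \<Rightarrow> real \<Rightarrow> 'a::banach) \<times> real set) set set) (alpha_dist a b)"
proof -
  interpret Metric_space "decorated_space a b :: ((real \<Rightarrow> real \<Rightarrow> 'a) \<times> real set) set set" "alpha_dist a b"
    by (rule decorated_Metric_space[OF assms])
  show ?thesis
  proof (rule mcomplete_if_fast_sequences_converge)
    fix \<sigma> :: "nat \<Rightarrow> ((real \<Rightarrow> real \<Rightarrow> 'a) \<times> real set) set"
    assume ran: "range \<sigma> \<subseteq> decorated_space a b" and fast: "\<And>n. alpha_dist a b (\<sigma> n) (\<sigma> (Suc n)) < (1/2) ^ n"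
    have "\<exists>x. x \<in> decorated_pairs a b \<and> \<sigma> n = alpha_rel a b `` {x}" for n
      using ran decorated_spaceE by (metis rangeI subsetD)
    then obtain x where x: "\<And>n. x n \<in> decorated_pairs a b" "\<And>n. \<sigma> n = alpha_rel a b `` {x n}" by metis
    have step: "alpha a b (x n) (x (Suc n)) < (1/2) ^ n" for n
      using fast[of n] by (simp add: x(2) alpha_dist_class[OF assms x(1) x(1)])
    obtain y where y: "y \<in> decorated_pairs a b" "\<And>n. alpha a b (x n) y \<le> 3 * (1/2) ^ n"
      by (rule fast_decorated_sequence_limit[where x = x, OF assms x(1) step]) blast
    have "limitin mtopology \<sigma> (alpha_rel a b `` {y}) sequentially"
      unfolding limitin_metric
    proof (intro conjI allI impI)
      show "alpha_rel a b `` {y} \<in> decorated_space a b"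
        using y(1) by (simp add: decorated_space_def quotientI)
      fix e :: real assume "e > 0"
      have "(\<lambda>n. 3 * (1/2::real) ^ n) \<longlonglongrightarrow> 0"
        by (rule tendsto_mult_right_zero) (rule LIMSEQ_power_zero; simp)
      from order_tendstoD(2)[OF this \<open>e > 0\<close>]
      show "\<forall>\<^sub>F n in sequentially. \<sigma> n \<in> decorated_space a b \<and> alpha_dist a b (\<sigma> n) (alpha_rel a b `` {y}) < e"
      proof eventually_elim
        case (elim n)
        then show ?case
          using ran y(2)[of n] by (auto simp: x(2) alpha_dist_class[OF assms x(1) y(1)])
      qed
    qed
    then show "\<exists>X. limitin mtopology \<sigma> X sequentially" ..
  qed
qed

section \<open>The trivial lift\<close>

lemma trivial_path_decorated:
  fixes h :: "real \<Rightarrow> 'a::real_normed_vector"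
  assumes "a < b" and h: "h \<in> cadlag_space {a..b}"
  shows "(trivial_path {a..b} h, {a}) \<in> decorated_pairs a b"
proof -
  have val: "trivial_path {a..b} h t s = h t" if "t \<in> {a..b}" "s \<in> {0..1}" for t s
    using that by (simp add: trivial_path_def)
  have "trivial_path {a..b} h t \<in> cadlag_space {0..1}" if t: "t \<in> {a..b}" for t
  proof -
    have "cadlag_on {0..1} (\<lambda>_. h t)" by (simp add: continuous_on_imp_cadlag_on)
    then have "cadlag_on {0..1} (trivial_path {a..b} h t)"
      using val[OF t] by (subst cadlag_on_cong) auto
    then show ?thesis using t by (simp add: cadlag_space_def trivial_path_def)
  qed
  then have "trivial_path {a..b} h \<in> {a..b} \<rightarrow>\<^sub>E cadlag_space {0..1}"
    by (auto simp: trivial_path_def)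
  moreover have "cadlag_on {a..b} (\<lambda>t. trivial_path {a..b} h t 1)"
    using h val by (subst cadlag_on_cong[of _ _ h]) (auto simp: cadlag_space_def)
  moreover have "stationary (trivial_path {a..b} h) t" if "t \<in> {a..b}" for t
    using val[OF that] by (auto simp: stationary_def)
  ultimately show ?thesis using \<open>a < b\<close> by (auto simp: decorated_pairs_def)
qed

text \<open>With \<open>{a}\<close> as the set of marked times the only rest is at the left endpoint, which is what prolonging
the path with identity clock amounts to.\<close>

lemma trivial_path_presents:
  fixes h :: "real \<Rightarrow> 'a::real_normed_vector"
  assumes "a < b"
  shows "presents a b (trivial_path {a..b} h, {a}) (prolong a (b, \<lambda>u. u, h))"
  unfolding prolong_def prod.case
proof (rule presentsI[where l = "\<lambda>t. if t = a then a else t + 1" and r = "\<lambda>t. t + 1"])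
  show "(\<lambda>u. max a (u - 1)) ` {a..b+1} = {a..b}"
  proof (intro equalityI subsetI)
    fix t assume "t \<in> {a..b}"
    then show "t \<in> (\<lambda>u. max a (u - 1)) ` {a..b+1}" by (intro image_eqI[of _ _ "t + 1"]) auto
  qed (use assms in auto)
  fix t u assume t: "t \<in> {a..b}" and u: "u \<in> {if t = a then a else t + 1..t + 1}"
  have "max a (u - 1) = t" using t u by (auto split: if_splits)
  then show "h (max a (u - 1)) = trivial_path {a..b} h t
      ((u - (if t = a then a else t + 1)) / (t + 1 - (if t = a then a else t + 1)))"
    using t u by (auto simp: trivial_path_def split: if_splits)
qed (use assms in \<open>auto simp: marks_def max_def intro!: mono_onI split: if_splits\<close>)

lemma matches_trivial_path:
  fixes h :: "real \<Rightarrow> 'a::real_normed_vector"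
  assumes "a < b" and h: "h \<in> cadlag_space {a..b}" and "\<eta> > 0"
  shows "matches a \<eta> (prolong a (b, \<lambda>u. u, h)) (b, \<lambda>u. u, h)"
  using assms by (intro matches_prolong) (auto simp: cadlag_space_def)

text \<open>Removing the initial rest costs nothing, and for identity clocks matchings are exactly what the J1
distance minimises.\<close>

lemma alpha_trivial_path:
  fixes h1 h2 :: "real \<Rightarrow> 'a::real_normed_vector"
  assumes "a < b" and h: "h1 \<in> cadlag_space {a..b}" "h2 \<in> cadlag_space {a..b}"
  shows "alpha a b (trivial_path {a..b} h1, {a}) (trivial_path {a..b} h2, {a}) = J1_dist {a..b} h1 h2"
    (is "?alpha = ?J")
proof (rule antisym)
  note dec = trivial_path_decorated[OF \<open>a < b\<close> h(1)] trivial_path_decorated[OF \<open>a < b\<close> h(2)]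
  note pres = trivial_path_presents[OF \<open>a < b\<close>, of h1] trivial_path_presents[OF \<open>a < b\<close>, of h2]
  have bdd: "bounded (h1 ` {a..b})" "bounded (h2 ` {a..b})"
    using h by (auto simp: cadlag_space_def intro: cadlag_on_bounded)
  show "?alpha \<le> ?J"
  proof (rule field_le_epsilon)
    fix \<epsilon> :: real assume "\<epsilon> > 0"
    then have eps: "\<epsilon>/3 > 0" by simp
    note near = matches_trivial_path[OF \<open>a < b\<close> h(1) eps] matches_trivial_path[OF \<open>a < b\<close> h(2) eps]
    have "matches a (?J + \<epsilon>/3) (b, \<lambda>u. u, h1) (b, \<lambda>u. u, h2)"
      using eps by (intro matches_if_J1_dist_less[OF bdd]) simp
    from matches_trans[OF near(1) matches_trans[OF this matches_sym[OF near(2)]]]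
    show "?alpha \<le> ?J + \<epsilon>" by (intro alpha_le[OF \<open>a < b\<close> dec pres]) (simp add: add.commute)
  qed
  show "?J \<le> ?alpha"
  proof (rule field_le_epsilon)
    fix \<epsilon> :: real assume "\<epsilon> > 0"
    then have eps: "\<epsilon>/3 > 0" by simp
    note near = matches_trivial_path[OF \<open>a < b\<close> h(1) eps] matches_trivial_path[OF \<open>a < b\<close> h(2) eps]
    have "matches a (?alpha + \<epsilon>/3) (prolong a (b, \<lambda>u. u, h1)) (prolong a (b, \<lambda>u. u, h2))"
      using eps by (intro matches_if_alpha_less[OF \<open>a < b\<close> dec pres]) simp
    from matches_trans[OF matches_sym[OF near(1)] matches_trans[OF this near(2)]]
    show "?J \<le> ?alpha + \<epsilon>" using \<open>a < b\<close> by (intro J1_dist_le) (simp_all add: add.commute)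
  qed
qed

text \<open>The extension with a small \<open>\<delta>\<close>, squeezed from \<open>{a..b+\<delta>}\<close> back to \<open>{a..b}\<close>, is a cadlag path close
to \<open>x\<close>: positions agree and times differ by at most \<open>2 * \<delta>\<close>.\<close>

lemma trivial_path_dense:
  fixes x :: "(real \<Rightarrow> real \<Rightarrow> 'a::real_normed_vector) \<times> real set"
  assumes "a < b" and x: "x \<in> decorated_pairs a b" and "\<epsilon> > 0"
  obtains h where "h \<in> cadlag_space {a..b}" "alpha a b x (trivial_path {a..b} h, {a}) < \<epsilon>"
proof -
  define \<delta> where "\<delta> = \<epsilon> / 4"
  have "\<delta> > 0" using \<open>\<epsilon> > 0\<close> by (simp add: \<delta>_def)
  obtain m f where X: "presents a b x (b + \<delta>, m, f)"
    and m: "\<And>u. u \<in> {a..b+\<delta>} \<Longrightarrow> \<bar>m u - u\<bar> \<le> \<delta>"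
    by (rule presents_near[OF \<open>a < b\<close> x \<open>\<delta> > 0\<close>]) blast
  define \<theta> where "\<theta> u = a + (u - a) * ((b + \<delta> - a) / (b - a))" for u
  have \<theta>: "strict_mono_on {a..b} \<theta>" "\<theta> ` {a..b} = {a..b+\<delta>}"
    unfolding \<theta>_def using affine_reparam[of a "b + \<delta>" b] \<open>a < b\<close> \<open>\<delta> > 0\<close> by simp_all
  have \<theta>_near: "\<bar>\<theta> u - u\<bar> \<le> \<delta>" if u: "u \<in> {a..b}" for u
  proof -
    have eq: "\<theta> u - u = \<delta> * ((u - a) / (b - a))"
      using \<open>a < b\<close> by (simp add: \<theta>_def field_simps)
    define c where "c = (u - a) / (b - a)"
    have "0 \<le> c" "c \<le> 1" using u \<open>a < b\<close> by (auto simp: c_def divide_le_eq_1)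
    then show ?thesis
      unfolding eq c_def[symmetric] using \<open>\<delta> > 0\<close> by (simp add: mult_left_le)
  qed
  define h where "h = restrict (\<lambda>u. f (\<theta> u)) {a..b}"
  have f: "cadlag_on {a..b+\<delta>} f" using X x by (cases x) (simp add: presents_cadlag)
  have mono: "mono_on {a..b} \<theta>" by (rule strict_mono_on_imp_mono_on[OF \<theta>(1)])
  have "cadlag_on {a..b} (\<lambda>u. f (\<theta> u))"
    by (rule cadlag_on_compose_mono[OF f mono mono_on_surj_continuous_on[OF mono \<theta>(2)]])
      (simp add: \<theta>(2))
  moreover have "cadlag_on {a..b} h \<longleftrightarrow> cadlag_on {a..b} (\<lambda>u. f (\<theta> u))"
    by (rule cadlag_on_cong) (simp add: h_def)
  ultimately have h: "h \<in> cadlag_space {a..b}" by (simp add: cadlag_space_def h_def)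
  have "matches a (2 * \<delta>) (b + \<delta>, m, f) (b, \<lambda>u. u, h)"
  proof (rule matchesI[OF \<theta>])
    fix u assume u: "u \<in> {a..b}"
    then have "\<theta> u \<in> {a..b+\<delta>}" using \<theta>(2) by blast
    from m[OF this] \<theta>_near[OF u] show "\<bar>m (\<theta> u) - u\<bar> \<le> 2 * \<delta>" by linarith
    show "norm (f (\<theta> u) - h u) \<le> 2 * \<delta>" using u \<open>\<delta> > 0\<close> by (simp add: h_def)
  qed
  from matches_trans[OF this matches_sym[OF matches_trivial_path[OF \<open>a < b\<close> h \<open>\<delta> > 0\<close>]]]
  have "alpha a b x (trivial_path {a..b} h, {a}) \<le> 2 * \<delta> + \<delta>"
    by (rule alpha_le[OF \<open>a < b\<close> x trivial_path_decorated[OF \<open>a < b\<close> h] X trivial_path_presents[OF \<open>a < b\<close>]])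
  then show ?thesis using \<open>\<epsilon> > 0\<close> by (intro that[OF h]) (simp add: \<delta>_def)
qed

theorem theorem1p2:
  fixes a b :: real
    and D :: "(real \<Rightarrow> real ^ 'd::finite) set"
    and DD :: "((real \<Rightarrow> real \<Rightarrow> real ^ 'd) \<times> real set) set set"
  assumes "a < b"
    and "D = cadlag_space {a..b}"
    and "DD = decorated_space a b"
  shows "Metric_space DD (alpha_dist a b)
       \<and> Metric_space.mcomplete DD (alpha_dist a b)
       \<and> trivial_lift a b \<in> D \<rightarrow> DD
       \<and> (\<forall>h1\<in>D. \<forall>h2\<in>D. alpha_dist a b (trivial_lift a b h1) (trivial_lift a b h2)
             = J1_dist {a..b} h1 h2)
       \<and> Metric_space.mtopology DD (alpha_dist a b) closure_of (trivial_lift a b ` D) = DD"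
proof (intro conjI)
  show M: "Metric_space DD (alpha_dist a b)"
    unfolding assms(3) by (rule decorated_Metric_space[OF assms(1)])
  show "Metric_space.mcomplete DD (alpha_dist a b)"
    unfolding assms(3) by (rule decorated_mcomplete[OF assms(1)])
  show lift: "trivial_lift a b \<in> D \<rightarrow> DD"
    using trivial_path_decorated[OF assms(1)]
    unfolding assms(2,3) trivial_lift_def decorated_space_def by (blast intro: quotientI)
  show "\<forall>h1\<in>D. \<forall>h2\<in>D. alpha_dist a b (trivial_lift a b h1) (trivial_lift a b h2) = J1_dist {a..b} h1 h2"
    by (simp add: assms(2) trivial_lift_def alpha_dist_class[OF assms(1)]
        trivial_path_decorated[OF assms(1)] alpha_trivial_path[OF assms(1)])
  interpret Metric_space DD "alpha_dist a b" by (rule M)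
  show "mtopology closure_of (trivial_lift a b ` D) = DD"
  proof (intro equalityI subsetI)
    fix X assume X: "X \<in> DD"
    then obtain x where x: "x \<in> decorated_pairs a b" "X = alpha_rel a b `` {x}"
      unfolding assms(3) by (rule decorated_spaceE)
    have "\<exists>Y\<in>trivial_lift a b ` D. Y \<in> mball X \<epsilon>" if "\<epsilon> > 0" for \<epsilon>
    proof -
      obtain h where h: "h \<in> D" "alpha a b x (trivial_path {a..b} h, {a}) < \<epsilon>"
        using trivial_path_dense[OF assms(1) x(1) \<open>\<epsilon> > 0\<close>] unfolding assms(2) by blast
      have "trivial_lift a b h \<in> mball X \<epsilon>"
      proof -
        have "alpha_dist a b X (trivial_lift a b h) = alpha a b x (trivial_path {a..b} h, {a})"
          unfolding x(2) trivial_lift_def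
          by (rule alpha_dist_class[OF assms(1) x(1) trivial_path_decorated[OF assms(1)]])
            (use h(1) assms(2) in simp)
        then show ?thesis using X lift h by auto
      qed
      then show ?thesis using h(1) by blast
    qed
    with X show "X \<in> mtopology closure_of (trivial_lift a b ` D)" by (simp add: metric_closure_of)
  qed (simp add: metric_closure_of)
qed

end
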